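(* For any projectors $P,Q$ and program $S$: (a) $\{P\};S\equiv\{P\};S;\{Q\}$ iff $sp.S.P\sqsubseteq Q$ iff $P\sqsubseteq wlp.S.Q$ iff $\models\{P\}S\{Q\}$; (b) $S;\{Q\}\equiv\{P\};S;\{Q\}$ iff $sp.S.P^\perp\sqsubseteq Q^\perp$ iff $P^\perp\sqsubseteq wlp.S.Q^\perp$ iff $\models\{P^\perp\}S\{Q^\perp\}$.
   Context: $V$ finite set of qubit variables, $\mathcal{H}_W=\bigotimes_{q\in W}\mathcal{H}_q$, $\mathcal{H}_q\cong\mathbb{C}^2$; operators on subsystems identified with their extension by identity to $\mathcal{H}_V$. Projectors identified with subspaces; $\sqsubseteq$ inclusion (Löwner order); $P^\perp$ orthocomplement. $\rho\models P$ iff the support of $\rho$ is contained in $P$. For a projector $P$ on a register $\bar q$, $\{P\}$ abbreviates the program $\mathbf{assert}\ P[\bar q]$, whose denotation is $\{\rho\mapsto P\rho P\}$. Programs: $S::=\mathbf{skip}\mid\mathbf{abort}\mid \bar q:=0\mid \bar q \mathrel{*}= U\mid \mathbf{assert}\ P[\bar q]\mid [P,Q]_{\bar q}\mid S_0\oplus_p S_1\mid S_0;S_1\mid \mathbf{if}\ P[\bar q]\ \mathbf{then}\ S_1\ \mathbf{else}\ S_0\ \mathbf{end}\mid \mathbf{while}\ P[\bar q]\ \mathbf{do}\ S\ \mathbf{end}$ with denotations (sets of super-operators): $\{\mathrm{id}\}$, $\{0\}$, $\{\rho\mapsto\sum_i|0\rangle_{\bar q}\langle i|\rho|i\rangle_{\bar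 q}\langle 0|\}$, $\{\rho\mapsto U\rho U^\dagger\}$, $\{\rho\mapsto P\rho P\}$, $\{\mathcal{E}$ completely positive trace-nonincreasing on $\mathcal{H}_{\bar q}:\forall\rho\models P,\mathcal{E}(\rho)\models Q\}$, $\{p\mathcal{E}_0+(1-p)\mathcal{E}_1\}$, $\{\mathcal{E}_1\circ\mathcal{E}_0\}$, $\{\mathcal{E}_1\circ\mathcal{P}+\mathcal{E}_0\circ\mathcal{P}^\perp\}$, $\{\sum_{k\ge0}\mathcal{P}^\perp\circ\mathcal{E}_k\circ\mathcal{P}\circ\cdots\circ\mathcal{E}_1\circ\mathcal{P}\}$ respectively, with $\mathcal{E}_i\in\llbracket S_i\rrbracket$ (resp. $\llbracket S\rrbracket$) chosen independently, $\mathcal{P}(\rho)=P\rho P$, $\mathcal{P}^\perp(\rho)=P^\perp\rho P^\perp$. $\models\{P\}S\{Q\}$ iff for all partial density operators $\rho$ on $\mathcal{H}_V$ and $\mathcal{E}\in\llbracket S\rrbracket$, $\rho\models P\Rightarrow\mathcal{E}(\rho)\models Q$. $wlp.S.Q$ is the (existing) $\sqsubseteq$-greatest $P$ with $\models\{P\}S\{Q\}$; $sp.S.P$ the (existing) $\sqsubseteq$-least $Q$ with $\models\{P\}S\{Q\}$. $S\sqsubseteq S'$ iff for all projectors $P,Q$, $\models\{P\}S\{Q\}\Rightarrow\models\{P\}S'\{Q\}$; $S\equiv S'$ iff $S\sqsubseteq S'$ and $S'\sqsubseteq S$. *)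

theory Defs
  imports Complex_Main "Jordan_Normal_Form.Matrix"
begin

section \<open>Linear-algebra basics on H_V, V = {0..<n} qubits, dim H_V = 2^n\<close>

type_synonym cmat = "complex mat"
type_synonym superop = "cmat \<Rightarrow> cmat"

definition adj :: "cmat \<Rightarrow> cmat" where
  "adj A = Matrix.mat (dim_col A) (dim_row A) (\<lambda>(i,j). cnj (A $$ (j,i)))"

definition tr :: "cmat \<Rightarrow> complex" where
  "tr A = (\<Sum>i<dim_row A. A $$ (i,i))"

definition psd :: "nat \<Rightarrow> cmat \<Rightarrow> bool" where
  "psd d A \<longleftrightarrow> A \<in> carrier_mat d d \<and>
     (\<forall>v \<in> carrier_vec d. Im (conjugate v \<bullet> (A *\<^sub>v v)) = 0 \<and> Re (conjugate v \<bullet> (A *\<^sub>v v)) \<ge> 0)"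

definition pdo :: "nat \<Rightarrow> cmat \<Rightarrow> bool" where
  "pdo d \<rho> \<longleftrightarrow> psd d \<rho> \<and> Re (tr \<rho>) \<le> 1"

definition is_proj :: "nat \<Rightarrow> cmat \<Rightarrow> bool" where
  "is_proj d P \<longleftrightarrow> P \<in> carrier_mat d d \<and> P * P = P \<and> adj P = P"

definition is_unitary :: "nat \<Rightarrow> cmat \<Rightarrow> bool" where
  "is_unitary d U \<longleftrightarrow> U \<in> carrier_mat d d \<and> U * adj U = 1\<^sub>m d \<and> adj U * U = 1\<^sub>m d"

definition range_op :: "nat \<Rightarrow> cmat \<Rightarrow> complex vec set" where
  "range_op d A = {A *\<^sub>v w | w. w \<in> carrier_vec d}"

definition models :: "nat \<Rightarrow> cmat \<Rightarrow> cmat \<Rightarrow> bool" where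
  "models d \<rho> P \<longleftrightarrow> range_op d \<rho> \<subseteq> range_op d P"

definition proj_le :: "nat \<Rightarrow> cmat \<Rightarrow> cmat \<Rightarrow> bool" where
  "proj_le d P Q \<longleftrightarrow> range_op d P \<subseteq> range_op d Q"

definition orth :: "nat \<Rightarrow> cmat \<Rightarrow> cmat" where
  "orth d P = 1\<^sub>m d - P"

(* bit q of a basis index; basis index i < 2^n encodes an assignment of
   the qubits 0..n-1, qubit q being bit q *)
definition bitv :: "nat \<Rightarrow> nat \<Rightarrow> bool" where
  "bitv i q = odd (i div 2 ^ q)"

definition idx_of :: "nat \<Rightarrow> (nat \<Rightarrow> bool) \<Rightarrow> nat" where
  "idx_of n f = (\<Sum>q<n. if f q then 2 ^ q else 0)"

(* local index of global basis index i w.r.t. register qs (qs!0 least significant) *)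
definition loc :: "nat list \<Rightarrow> nat \<Rightarrow> nat" where
  "loc qs i = (\<Sum>t<length qs. if bitv i (qs ! t) then 2 ^ t else 0)"

fun upd_bits :: "(nat \<Rightarrow> bool) \<Rightarrow> nat list \<Rightarrow> nat \<Rightarrow> (nat \<Rightarrow> bool)" where
  "upd_bits f [] a = f"
| "upd_bits f (q # qs) a = upd_bits (f(q := odd a)) qs (a div 2)"

definition place :: "nat \<Rightarrow> nat list \<Rightarrow> nat \<Rightarrow> nat \<Rightarrow> nat" where
  "place n qs i a = idx_of n (upd_bits (bitv i) qs a)"

definition reg_ok :: "nat \<Rightarrow> nat list \<Rightarrow> bool" where
  "reg_ok n qs \<longleftrightarrow> distinct qs \<and> set qs \<subseteq> {..<n}"

(* operator A on H_qs extended by identity to H_V, i.e. A \<otimes> I *)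
definition ext_op :: "nat \<Rightarrow> nat list \<Rightarrow> cmat \<Rightarrow> cmat" where
  "ext_op n qs A = Matrix.mat (2 ^ n) (2 ^ n) (\<lambda>(i,j).
     if (\<forall>q<n. q \<notin> set qs \<longrightarrow> bitv i q = bitv j q)
     then A $$ (loc qs i, loc qs j) else 0)"

(* super-operator E on H_qs extended to H_V, i.e. E \<otimes> id *)
definition ext_so :: "nat \<Rightarrow> nat list \<Rightarrow> superop \<Rightarrow> superop" where
  "ext_so n qs E \<rho> = Matrix.mat (2 ^ n) (2 ^ n) (\<lambda>(i,j).
     E (Matrix.mat (2 ^ length qs) (2 ^ length qs)
          (\<lambda>(a,b). \<rho> $$ (place n qs i a, place n qs j b))) $$ (loc qs i, loc qs j))"

definition cp_tni :: "nat \<Rightarrow> superop \<Rightarrow> bool" where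
  "cp_tni k E \<longleftrightarrow>
     (\<forall>A \<in> carrier_mat (2^k) (2^k). E A \<in> carrier_mat (2^k) (2^k)) \<and>
     (\<forall>A \<in> carrier_mat (2^k) (2^k). \<forall>B \<in> carrier_mat (2^k) (2^k). \<forall>c.
         E (c \<cdot>\<^sub>m A + B) = c \<cdot>\<^sub>m E A + E B) \<and>
     (\<forall>m \<rho>. psd (2 ^ (k + m)) \<rho> \<longrightarrow> psd (2 ^ (k + m)) (ext_so (k + m) [0..<k] E \<rho>)) \<and>
     (\<forall>\<rho>. psd (2 ^ k) \<rho> \<longrightarrow> Re (tr (E \<rho>)) \<le> Re (tr \<rho>))"

datatype prog =
    Skip
  | Abort
  | Init "nat list"
  | Unit "nat list" cmat
  | Assert cmat "nat list"
  | Spec cmat cmat "nat list"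
  | Choice prog real prog
  | Seq prog prog
  | If cmat "nat list" prog prog
  | While cmat "nat list" prog

fun wf_prog :: "nat \<Rightarrow> prog \<Rightarrow> bool" where
  "wf_prog n Skip = True"
| "wf_prog n Abort = True"
| "wf_prog n (Init qs) = reg_ok n qs"
| "wf_prog n (Unit qs U) = (reg_ok n qs \<and> is_unitary (2 ^ length qs) U)"
| "wf_prog n (Assert P qs) = (reg_ok n qs \<and> is_proj (2 ^ length qs) P)"
| "wf_prog n (Spec P Q qs) = (reg_ok n qs \<and> is_proj (2 ^ length qs) P \<and> is_proj (2 ^ length qs) Q)"
| "wf_prog n (Choice S0 p S1) = (0 \<le> p \<and> p \<le> 1 \<and> wf_prog n S0 \<and> wf_prog n S1)"
| "wf_prog n (Seq S0 S1) = (wf_prog n S0 \<and> wf_prog n S1)"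
| "wf_prog n (If P qs S1 S0) = (reg_ok n qs \<and> is_proj (2 ^ length qs) P \<and> wf_prog n S1 \<and> wf_prog n S0)"
| "wf_prog n (While P qs S) = (reg_ok n qs \<and> is_proj (2 ^ length qs) P \<and> wf_prog n S)"

definition ket0bra :: "nat \<Rightarrow> nat \<Rightarrow> cmat" where
  "ket0bra k i = Matrix.mat (2^k) (2^k) (\<lambda>(a,b). if a = 0 \<and> b = i then 1 else 0)"

definition sandwich :: "cmat \<Rightarrow> superop" where
  "sandwich A \<rho> = A * \<rho> * adj A"

definition msum :: "nat \<Rightarrow> cmat list \<Rightarrow> cmat" where
  "msum d As = foldr (+) As (0\<^sub>m d d)"

definition minfsum :: "nat \<Rightarrow> (nat \<Rightarrow> cmat) \<Rightarrow> cmat" where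
  "minfsum d f = Matrix.mat d d (\<lambda>(i,j). \<Sum>k. f k $$ (i,j))"

fun loop_iter :: "superop \<Rightarrow> (nat \<Rightarrow> superop) \<Rightarrow> cmat \<Rightarrow> nat \<Rightarrow> cmat" where
  "loop_iter Pm Es \<rho> 0 = \<rho>"
| "loop_iter Pm Es \<rho> (Suc k) = Es (Suc k) (Pm (loop_iter Pm Es \<rho> k))"

fun den :: "nat \<Rightarrow> prog \<Rightarrow> superop set" where
  "den n Skip = {id}"
| "den n Abort = {\<lambda>\<rho>. 0\<^sub>m (2^n) (2^n)}"
| "den n (Init qs) = {\<lambda>\<rho>. msum (2^n)
      (map (\<lambda>i. sandwich (ext_op n qs (ket0bra (length qs) i)) \<rho>) [0..<2 ^ length qs])}"
| "den n (Unit qs U) = {sandwich (ext_op n qs U)}"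
| "den n (Assert P qs) = {sandwich (ext_op n qs P)}"
| "den n (Spec P Q qs) = {ext_so n qs E | E. cp_tni (length qs) E \<and>
      (\<forall>\<rho>. pdo (2 ^ length qs) \<rho> \<and> models (2 ^ length qs) \<rho> P
             \<longrightarrow> models (2 ^ length qs) (E \<rho>) Q)}"
| "den n (Choice S0 p S1) = {\<lambda>\<rho>. complex_of_real p \<cdot>\<^sub>m E0 \<rho> + complex_of_real (1 - p) \<cdot>\<^sub>m E1 \<rho>
      | E0 E1. E0 \<in> den n S0 \<and> E1 \<in> den n S1}"
| "den n (Seq S0 S1) = {E1 \<circ> E0 | E0 E1. E0 \<in> den n S0 \<and> E1 \<in> den n S1}"
| "den n (If P qs S1 S0) = {\<lambda>\<rho>. E1 (sandwich (ext_op n qs P) \<rho>)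
         + E0 (sandwich (ext_op n qs (orth (2 ^ length qs) P)) \<rho>)
      | E0 E1. E0 \<in> den n S0 \<and> E1 \<in> den n S1}"
| "den n (While P qs S) = {\<lambda>\<rho>. minfsum (2^n) (\<lambda>k.
         sandwich (ext_op n qs (orth (2 ^ length qs) P))
           (loop_iter (sandwich (ext_op n qs P)) Es \<rho> k))
      | Es. \<forall>k. Es k \<in> den n S}"

definition valid :: "nat \<Rightarrow> cmat \<Rightarrow> prog \<Rightarrow> cmat \<Rightarrow> bool" where
  "valid n P S Q \<longleftrightarrow> (\<forall>\<rho> E. pdo (2^n) \<rho> \<and> E \<in> den n S \<and> models (2^n) \<rho> P
                              \<longrightarrow> models (2^n) (E \<rho>) Q)"

definition wlp :: "nat \<Rightarrow> prog \<Rightarrow> cmat \<Rightarrow> cmat" where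
  "wlp n S Q = (THE P. is_proj (2^n) P \<and> valid n P S Q \<and>
      (\<forall>P'. is_proj (2^n) P' \<and> valid n P' S Q \<longrightarrow> proj_le (2^n) P' P))"

definition sp :: "nat \<Rightarrow> prog \<Rightarrow> cmat \<Rightarrow> cmat" where
  "sp n S P = (THE Q. is_proj (2^n) Q \<and> valid n P S Q \<and>
      (\<forall>Q'. is_proj (2^n) Q' \<and> valid n P S Q' \<longrightarrow> proj_le (2^n) Q Q'))"

definition refines :: "nat \<Rightarrow> prog \<Rightarrow> prog \<Rightarrow> bool" where
  "refines n S S' \<longleftrightarrow> (\<forall>P Q. is_proj (2^n) P \<and> is_proj (2^n) Q \<longrightarrow>
                          valid n P S Q \<longrightarrow> valid n P S' Q)"

definition prog_equiv :: "nat \<Rightarrow> prog \<Rightarrow> prog \<Rightarrow> bool" where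
  "prog_equiv n S S' \<longleftrightarrow> refines n S S' \<and> refines n S' S"

definition assertV :: "nat \<Rightarrow> cmat \<Rightarrow> prog" where
  "assertV n P = Assert P [0..<n]"

end

theory Submission
  imports Defs
begin

text \<open>Denotations are additive, positive and trace-nonincreasing on the psd cone, and for psd \<open>A\<close> the
  condition that its support lies in \<open>Q\<close> means \<open>Q\<^sup>\<bottom> A Q\<^sup>\<bottom> = 0\<close>, which is additive and monotone in \<open>A\<close>.
  Hence the vectors \<open>v\<close> whose rank-one state is sent into \<open>Q\<close> form a subspace (parallelogram identity),
  namely \<open>wlp.S.Q\<close>; dually \<open>sp.S.P\<close> is the intersection of all valid postconditions.
  For the equivalences, (a) tests the refinement on the postcondition \<open>Q\<close>, and (b) tests it on \<open>P\<^sup>\<bottom>\<close>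
  and \<open>0\<close>; conversely, if \<open>\<rho> \<mapsto> Q E(\<rho>) Q\<close> annihilates the block \<open>P\<^sup>\<bottom> \<rho> P\<^sup>\<bottom>\<close>, then by positivity the
  off-diagonal blocks do not affect the support of the output either.\<close>

section \<open>Positive semidefinite matrices\<close>

text \<open>Two obstacles shape the proof. A denotation may be evaluated at psd arguments only, so a
  state cannot be split into its four blocks with respect to P and the off-diagonal ones sent
  through E separately. The parallelogram identity, with \<open>X = A \<rho> adj A\<close> and its
  variants for \<open>B\<close> and \<open>A + B\<close>, \<open>A - B\<close>, avoids this: the
  cross terms cancel and every remaining term is psd. It serves both for the closure of wlp under
  addition and for the converse in (b). The other obstacle is that validity concerns all states,
  whereas wlp is built from rank-one states. Instead of a spectral decomposition of \<rho>, the
  projector R itself is used as an unnormalised state: it is assembled from rank-one summands, every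
  \<rho> supported in R satisfies \<open>\<rho> + \<sigma> = c R\<close> for some psd \<sigma> and
  \<open>c > 0\<close>, and a summand of a state sent into Q is sent into Q. The test on the zero
  postcondition works because \<open>Q A Q = 0\<close> says, for psd A, that A is supported in the
  orthocomplement of Q.\<close>

definition bform :: "nat \<Rightarrow> cmat \<Rightarrow> (nat \<Rightarrow> complex) \<Rightarrow> (nat \<Rightarrow> complex) \<Rightarrow> complex" where
  "bform d A u v = (\<Sum>i<d. \<Sum>j<d. cnj (u i) * A $$ (i,j) * v j)"

lemma adj_dim [simp]: "dim_row (adj A) = dim_col A" "dim_col (adj A) = dim_row A"
  by (auto simp: adj_def)

lemma adj_carrier [simp]: "A \<in> carrier_mat m n \<Longrightarrow> adj A \<in> carrier_mat n m"
  by (auto simp: adj_def)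

lemma adj_index [simp]: "i < dim_col A \<Longrightarrow> j < dim_row A \<Longrightarrow> adj A $$ (i,j) = cnj (A $$ (j,i))"
  by (auto simp: adj_def)

lemma adj_adj [simp]: "adj (adj A) = A"
  by (intro eq_matI) auto

lemma mult_index:
  assumes "A \<in> carrier_mat m d" "B \<in> carrier_mat d n" "i < m" "j < n"
  shows "(A * B) $$ (i,j) = (\<Sum>k<d. A $$ (i,k) * B $$ (k,j))"
  using assms by (auto simp: scalar_prod_def lessThan_atLeast0 intro!: sum.cong)

lemma mult_vec_index:
  assumes "A \<in> carrier_mat m d" "v \<in> carrier_vec d" "i < m"
  shows "(A *\<^sub>v v) $ i = (\<Sum>k<d. A $$ (i,k) * v $ k)"
  using assms by (auto simp: scalar_prod_def lessThan_atLeast0 intro!: sum.cong)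

declare index_mult_mat(1) [simp del] index_mult_mat_vec [simp del]

lemma adj_mult:
  assumes "A \<in> carrier_mat m d" "B \<in> carrier_mat d n"
  shows "adj (A * B) = adj B * adj A"
  using assms by (intro eq_matI) (auto simp: mult_index[of _ m d _ n] mult_index[of _ n d _ m] mult.commute)

lemma adj_add:
  assumes "A \<in> carrier_mat m d" "B \<in> carrier_mat m d"
  shows "adj (A + B) = adj A + adj B"
  using assms by (intro eq_matI) auto

lemma adj_minus:
  assumes "A \<in> carrier_mat m d" "B \<in> carrier_mat m d"
  shows "adj (A - B) = adj A - adj B"
  using assms by (intro eq_matI) auto

lemma adj_one [simp]: "adj (1\<^sub>m d) = 1\<^sub>m d"
  by (intro eq_matI) auto

lemma adj_zero [simp]: "adj (0\<^sub>m m d) = 0\<^sub>m d m"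
  by (intro eq_matI) auto

lemma psd_carrier: "psd d A \<Longrightarrow> A \<in> carrier_mat d d"
  by (simp add: psd_def)

lemma quadratic_form_eq_bform:
  assumes "A \<in> carrier_mat d d" "v \<in> carrier_vec d"
  shows "conjugate v \<bullet> (A *\<^sub>v v) = bform d A (\<lambda>i. v $ i) (\<lambda>i. v $ i)"
proof -
  have "conjugate v \<bullet> (A *\<^sub>v v) = (\<Sum>i<d. cnj (v $ i) * (A *\<^sub>v v) $ i)"
    unfolding scalar_prod_def using assms by (auto simp: lessThan_atLeast0 intro!: sum.cong)
  also have "\<dots> = bform d A (\<lambda>i. v $ i) (\<lambda>i. v $ i)"
    using assms unfolding bform_def
    by (auto simp: mult_vec_index[OF assms] sum_distrib_left mult.assoc intro!: sum.cong)
  finally show ?thesis .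
qed

lemma bform_cong:
  assumes "\<And>i. i < d \<Longrightarrow> u i = u' i" "\<And>i. i < d \<Longrightarrow> v i = v' i"
  shows "bform d A u v = bform d A u' v'"
  unfolding bform_def using assms by (intro sum.cong) auto

text \<open>Test vectors become plain functions, so they can be written as lambda terms and combined
  without carrier conditions; only their values below d enter the form.\<close>

lemma psd_iff_bform:
  "psd d A \<longleftrightarrow> A \<in> carrier_mat d d \<and> (\<forall>v. Im (bform d A v v) = 0 \<and> 0 \<le> Re (bform d A v v))"
proof (cases "A \<in> carrier_mat d d")
  case True
  have "bform d A v v = conjugate (vec d v) \<bullet> (A *\<^sub>v vec d v)" for v
    using quadratic_form_eq_bform[OF True, of "vec d v"] bform_cong[of d "\<lambda>i. vec d v $ i" v]
    by simp
  then show ?thesis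
    using True quadratic_form_eq_bform[OF True] unfolding psd_def by (metis vec_carrier)
qed (auto simp: psd_def)

lemma psdD: "psd d A \<Longrightarrow> Im (bform d A v v) = 0" "psd d A \<Longrightarrow> 0 \<le> Re (bform d A v v)"
  by (auto simp: psd_iff_bform)

lemma bform_add_left: "bform d A (\<lambda>i. u i + u' i) v = bform d A u v + bform d A u' v"
  and bform_add_right: "bform d A u (\<lambda>i. v i + v' i) = bform d A u v + bform d A u v'"
  and bform_scale_left: "bform d A (\<lambda>i. c * u i) v = cnj c * bform d A u v"
  and bform_scale_right: "bform d A u (\<lambda>i. c * v i) = c * bform d A u v"
  by (simp_all add: bform_def algebra_simps sum.distrib sum_distrib_left)

lemma bform_delta:
  assumes "i < d"
  shows "bform d A (\<lambda>k. if k = i then 1 else 0) v = (\<Sum>j<d. A $$ (i,j) * v j)"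
proof -
  have "bform d A (\<lambda>k. if k = i then 1 else 0) v = (\<Sum>k<d. if k = i then \<Sum>j<d. A $$ (k,j) * v j else 0)"
    unfolding bform_def by (intro sum.cong) auto
  then show ?thesis using assms by simp
qed

lemma bform_delta_delta:
  assumes "i < d" "j < d"
  shows "bform d A (\<lambda>k. if k = i then 1 else 0) (\<lambda>k. if k = j then 1 else 0) = A $$ (i,j)"
proof -
  have "(\<Sum>k<d. A $$ (i,k) * (if k = j then 1 else 0)) = (\<Sum>k<d. if k = j then A $$ (i,k) else 0)"
    by (intro sum.cong) auto
  then show ?thesis using assms by (simp add: bform_delta)
qed

text \<open>Polarization: \<open>psd\<close> only demands real values of the quadratic form. Reality
  at \<open>u + v\<close> and at \<open>u + \<i> v\<close> fixes the imaginary part of the sum and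
  the real part of the difference of the two mixed terms.\<close>

lemma psd_bform_sym:
  assumes "psd d A"
  shows "bform d A v u = cnj (bform d A u v)"
proof -
  have expand: "bform d A (\<lambda>i. u i + z * v i) (\<lambda>i. u i + z * v i) =
      bform d A u u + z * bform d A u v + cnj z * bform d A v u + cnj z * z * bform d A v v" for z
    by (simp only: bform_add_left bform_add_right bform_scale_left bform_scale_right) (simp add: algebra_simps)
  have im: "Im (bform d A u u) = 0" "Im (bform d A v v) = 0"
    "Im (bform d A (\<lambda>i. u i + z * v i) (\<lambda>i. u i + z * v i)) = 0" for z
    using psdD(1)[OF assms] by blast+
  have "Im (bform d A u v + bform d A v u) = 0"
    using im(3)[of 1] im(1,2) unfolding expand by simp
  moreover have "Re (bform d A u v - bform d A v u) = 0"
    using im(3)[of \<i>] im(1,2) unfolding expand by simp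
  ultimately show ?thesis by (simp add: complex_eq_iff)
qed

lemma psd_hermitian_index:
  assumes "psd d A" "i < d" "j < d"
  shows "A $$ (j,i) = cnj (A $$ (i,j))"
  using psd_bform_sym[OF assms(1)] bform_delta_delta assms by metis

lemma psd_hermitian: "psd d A \<Longrightarrow> adj A = A"
  using psd_carrier[of d A] psd_hermitian_index[of d A] by (intro eq_matI) (metis adj_dim adj_index carrier_matD)+

lemma psd_bform_expand:
  assumes "psd d A"
  shows "0 \<le> Re (bform d A u u) + 2 * Re (z * bform d A u v) + (cmod z)\<^sup>2 * Re (bform d A v v)"
proof -
  have "0 \<le> Re (bform d A (\<lambda>i. u i + z * v i) (\<lambda>i. u i + z * v i))"
    using psdD(2)[OF assms] .
  also have "bform d A (\<lambda>i. u i + z * v i) (\<lambda>i. u i + z * v i) =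
      bform d A u u + z * bform d A u v + cnj (z * bform d A u v) + (z * cnj z) * bform d A v v"
    by (simp only: bform_add_left bform_add_right bform_scale_left bform_scale_right)
      (simp add: algebra_simps psd_bform_sym[OF assms, of v u])
  finally show ?thesis
    by (simp add: complex_mult_cnj cmod_power2 flip: of_real_power of_real_add)
qed

text \<open>With v isotropic the expansion at \<open>u + z v\<close> has no quadratic term in z, so
  a nonzero mixed term would make it negative for a suitable z.\<close>

lemma psd_null_vector:
  assumes A: "psd d A" and "Re (bform d A v v) = 0"
  shows "bform d A u v = 0"
proof (rule ccontr)
  let ?y = "bform d A u v"
  assume "?y \<noteq> 0"
  \<comment> \<open>The choice makes the mixed term contribute \<open>-2 (q + 1)\<close>, where q is
    the form at u, so the expansion equals \<open>-q - 2\<close>, which is negative.\<close>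
  define t where "t = (Re (bform d A u u) + 1) / (cmod ?y)\<^sup>2"
  have "Re ((- of_real t * cnj ?y) * ?y) = - (t * (cmod ?y)\<^sup>2)"
    unfolding cmod_power2 by (simp add: power2_eq_square algebra_simps)
  then have "Re ((- of_real t * cnj ?y) * ?y) = - (Re (bform d A u u) + 1)"
    using \<open>?y \<noteq> 0\<close> by (simp add: t_def)
  with psd_bform_expand[OF A, of u "- of_real t * cnj ?y" v] assms(2) psdD(2)[OF A, of u]
  show False by simp
qed

lemma psd_diag_nonneg: "psd d A \<Longrightarrow> i < d \<Longrightarrow> 0 \<le> Re (A $$ (i,i))"
  using psdD(2)[of d A "\<lambda>k. if k = i then 1 else 0"] by (simp add: bform_delta_delta)

lemma Re_tr: "A \<in> carrier_mat d d \<Longrightarrow> Re (tr A) = (\<Sum>i<d. Re (A $$ (i,i)))"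
  by (auto simp: tr_def)

lemma psd_tr_nonneg: "psd d A \<Longrightarrow> 0 \<le> Re (tr A)"
  using psd_diag_nonneg[of d A] by (auto simp: Re_tr[OF psd_carrier] intro!: sum_nonneg)

lemma psd_diag_le_tr: "psd d A \<Longrightarrow> i < d \<Longrightarrow> Re (A $$ (i,i)) \<le> Re (tr A)"
  using psd_diag_nonneg[of d A] unfolding Re_tr[OF psd_carrier] by (intro member_le_sum) auto

lemma psd_index_le_tr:
  assumes A: "psd d A" and ij: "i < d" "j < d"
  shows "cmod (A $$ (i,j)) \<le> Re (tr A)"
proof (cases "A $$ (i,j) = 0")
  case True
  then show ?thesis using psd_tr_nonneg[OF A] by simp
next
  case False
  let ?e = "\<lambda>j k. if k = j then 1 else 0 :: complex"
  \<comment> \<open>A phase that turns the entry into minus its modulus; the form at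
    \<open>e_i + z e_j\<close> then bounds twice the modulus by the sum of two diagonal
    entries.\<close>
  define z where "z = - cnj (A $$ (i,j)) / of_real (cmod (A $$ (i,j)))"
  have "z * A $$ (i,j) = - of_real (cmod (A $$ (i,j)))"
    using False complex_norm_square[of "A $$ (i,j)"]
    by (simp add: z_def divide_simps power2_eq_square mult.commute)
  moreover have "cmod z = 1" using False by (simp add: z_def norm_divide)
  ultimately have "2 * cmod (A $$ (i,j)) \<le> Re (A $$ (i,i)) + Re (A $$ (j,j))"
    using psd_bform_expand[OF A, of "?e i" z "?e j"] ij by (simp add: bform_delta_delta)
  then show ?thesis using psd_diag_le_tr[OF A ij(1)] psd_diag_le_tr[OF A ij(2)] by linarith
qed

lemma psd_tr_zero: "psd d A \<Longrightarrow> Re (tr A) = 0 \<Longrightarrow> A = 0\<^sub>m d d"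
  using psd_index_le_tr[of d A] psd_carrier[of d A] by (intro eq_matI) auto

lemma bform_add:
  assumes "A \<in> carrier_mat d d" "B \<in> carrier_mat d d"
  shows "bform d (A + B) u v = bform d A u v + bform d B u v"
  using assms by (simp add: bform_def algebra_simps sum.distrib)

lemma bform_smult:
  assumes "A \<in> carrier_mat d d"
  shows "bform d (c \<cdot>\<^sub>m A) u v = c * bform d A u v"
  using assms by (simp add: bform_def sum_distrib_left algebra_simps)

lemma psd_add: "psd d A \<Longrightarrow> psd d B \<Longrightarrow> psd d (A + B)"
  by (auto simp: psd_iff_bform bform_add)

lemma psd_smult: "psd d A \<Longrightarrow> 0 \<le> c \<Longrightarrow> psd d (complex_of_real c \<cdot>\<^sub>m A)"
  by (auto simp: psd_iff_bform bform_smult)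

lemma psd_zero [simp]: "psd d (0\<^sub>m d d)"
  by (auto simp: psd_iff_bform bform_def)

lemma bform_one: "bform d (1\<^sub>m d) u v = (\<Sum>i<d. cnj (u i) * v i)"
proof -
  have "bform d (1\<^sub>m d) u v = (\<Sum>i<d. \<Sum>j<d. if i = j then cnj (u i) * v j else 0)"
    unfolding bform_def by (intro sum.cong) auto
  then show ?thesis by simp
qed

lemma cnj_mult_self: "cnj z * z = of_real ((cmod z)\<^sup>2)"
  using complex_norm_square[of z] by (simp add: mult.commute)

lemma psd_one [simp]: "psd d (1\<^sub>m d)"
  by (auto simp: psd_iff_bform bform_one cnj_mult_self intro!: sum_nonneg)

section \<open>Conjugation by a matrix\<close>

lemma sandwich_carrier [simp]:
  "A \<in> carrier_mat d e \<Longrightarrow> \<rho> \<in> carrier_mat e e \<Longrightarrow> sandwich A \<rho> \<in> carrier_mat d d"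
  by (auto simp: sandwich_def)

lemma sandwich_dim [simp]: "dim_row (sandwich A \<rho>) = dim_row A" "dim_col (sandwich A \<rho>) = dim_row A"
  by (auto simp: sandwich_def)

lemma sandwich_index:
  assumes "A \<in> carrier_mat d e" "\<rho> \<in> carrier_mat e e" "i < d" "j < d"
  shows "sandwich A \<rho> $$ (i,j) = (\<Sum>k<e. \<Sum>l<e. A $$ (i,k) * \<rho> $$ (k,l) * cnj (A $$ (j,l)))"
proof -
  have "sandwich A \<rho> $$ (i,j) = (\<Sum>l<e. (\<Sum>k<e. A $$ (i,k) * \<rho> $$ (k,l)) * cnj (A $$ (j,l)))"
    unfolding sandwich_def using assms
    by (subst mult_index[of _ d e _ d]) (auto simp: mult_index[of A d e \<rho> e] intro!: sum.cong)
  also have "\<dots> = (\<Sum>k<e. \<Sum>l<e. A $$ (i,k) * \<rho> $$ (k,l) * cnj (A $$ (j,l)))"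
    unfolding sum_distrib_right by (rule sum.swap)
  finally show ?thesis .
qed

text \<open>Moving A to the other side of the form: both arguments are replaced by their images
  under \<open>adj A\<close>.\<close>

lemma bform_sandwich:
  assumes "A \<in> carrier_mat d e" "\<rho> \<in> carrier_mat e e"
  shows "bform d (sandwich A \<rho>) u v =
    bform e \<rho> (\<lambda>k. \<Sum>i<d. cnj (A $$ (i,k)) * u i) (\<lambda>l. \<Sum>j<d. cnj (A $$ (j,l)) * v j)"
proof -
  have "bform d (sandwich A \<rho>) u v =
      (\<Sum>i<d. \<Sum>j<d. \<Sum>k<e. \<Sum>l<e. cnj (u i) * A $$ (i,k) * \<rho> $$ (k,l) * (cnj (A $$ (j,l)) * v j))"
    unfolding bform_def using assms
    by (intro sum.cong) (auto simp: sandwich_index sum_distrib_left sum_distrib_right algebra_simps)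
  also have "\<dots> = (\<Sum>i<d. \<Sum>k<e. \<Sum>j<d. \<Sum>l<e. cnj (u i) * A $$ (i,k) * \<rho> $$ (k,l) * (cnj (A $$ (j,l)) * v j))"
    by (rule sum.cong[OF refl sum.swap])
  also have "\<dots> = (\<Sum>k<e. \<Sum>i<d. \<Sum>l<e. \<Sum>j<d. cnj (u i) * A $$ (i,k) * \<rho> $$ (k,l) * (cnj (A $$ (j,l)) * v j))"
    by (subst sum.swap) (intro sum.cong refl sum.swap)
  also have "\<dots> = (\<Sum>k<e. \<Sum>l<e. \<Sum>i<d. \<Sum>j<d. cnj (u i) * A $$ (i,k) * \<rho> $$ (k,l) * (cnj (A $$ (j,l)) * v j))"
    by (rule sum.cong[OF refl sum.swap])
  also have "\<dots> = bform e \<rho> (\<lambda>k. \<Sum>i<d. cnj (A $$ (i,k)) * u i) (\<lambda>l. \<Sum>j<d. cnj (A $$ (j,l)) * v j)"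
    unfolding bform_def
    by (simp add: sum_distrib_left sum_distrib_right mult.commute)
  finally show ?thesis .
qed

lemma psd_sandwich:
  assumes "A \<in> carrier_mat d e" "psd e \<rho>"
  shows "psd d (sandwich A \<rho>)"
  using assms psdD[OF assms(2)] by (auto simp: psd_iff_bform bform_sandwich)

lemma sandwich_add:
  assumes "A \<in> carrier_mat d e" "\<rho> \<in> carrier_mat e e" "\<sigma> \<in> carrier_mat e e"
  shows "sandwich A (\<rho> + \<sigma>) = sandwich A \<rho> + sandwich A \<sigma>"
  by (rule eq_matI) (use assms in \<open>auto simp: sandwich_index[of A d e] sum.distrib algebra_simps\<close>)

lemma sandwich_smult:
  assumes "A \<in> carrier_mat d e" "\<rho> \<in> carrier_mat e e"
  shows "sandwich A (c \<cdot>\<^sub>m \<rho>) = c \<cdot>\<^sub>m sandwich A \<rho>"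
  by (rule eq_matI) (use assms in \<open>auto simp: sandwich_index[of A d e] sum_distrib_left algebra_simps\<close>)

lemma sandwich_parallelogram:
  assumes "A \<in> carrier_mat d e" "B \<in> carrier_mat d e" "\<rho> \<in> carrier_mat e e"
  shows "sandwich (A + B) \<rho> + sandwich (A - B) \<rho> = 2 \<cdot>\<^sub>m sandwich A \<rho> + 2 \<cdot>\<^sub>m sandwich B \<rho>"
proof (rule eq_matI)
  fix i j assume "i < dim_row (2 \<cdot>\<^sub>m sandwich A \<rho> + 2 \<cdot>\<^sub>m sandwich B \<rho>)"
    "j < dim_col (2 \<cdot>\<^sub>m sandwich A \<rho> + 2 \<cdot>\<^sub>m sandwich B \<rho>)"
  then have ij: "i < d" "j < d" using assms by auto
  have "sandwich (A + B) \<rho> $$ (i,j) + sandwich (A - B) \<rho> $$ (i,j)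
      = 2 * sandwich A \<rho> $$ (i,j) + 2 * sandwich B \<rho> $$ (i,j)"
    unfolding sandwich_index[OF add_carrier_mat[OF assms(2)] assms(3) ij]
      sandwich_index[OF minus_carrier_mat[OF assms(2)] assms(3) ij]
      sandwich_index[OF assms(1,3) ij] sandwich_index[OF assms(2,3) ij] sum_distrib_left sum.distrib[symmetric]
    using assms ij by (intro sum.cong refl) (simp add: algebra_simps)
  then show "(sandwich (A + B) \<rho> + sandwich (A - B) \<rho>) $$ (i,j)
      = (2 \<cdot>\<^sub>m sandwich A \<rho> + 2 \<cdot>\<^sub>m sandwich B \<rho>) $$ (i,j)"
    using assms ij by simp
qed (use assms in auto)

lemma tr_add: "A \<in> carrier_mat d d \<Longrightarrow> B \<in> carrier_mat d d \<Longrightarrow> tr (A + B) = tr A + tr B"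
  by (auto simp: tr_def sum.distrib)

lemma tr_smult: "tr (c \<cdot>\<^sub>m A) = c * tr A" if "A \<in> carrier_mat d d"
  using that by (auto simp: tr_def sum_distrib_left)

text \<open>Cyclicity of the trace, written entrywise. Trace bounds thus depend only on the Gram
  matrix \<open>adj A * A\<close>.\<close>

lemma tr_sandwich:
  assumes "A \<in> carrier_mat d e" "\<rho> \<in> carrier_mat e e"
  shows "tr (sandwich A \<rho>) = (\<Sum>k<e. \<Sum>l<e. (adj A * A) $$ (l,k) * \<rho> $$ (k,l))"
proof -
  have "tr (sandwich A \<rho>) = (\<Sum>i<d. \<Sum>k<e. \<Sum>l<e. A $$ (i,k) * \<rho> $$ (k,l) * cnj (A $$ (i,l)))"
    using assms by (auto simp: tr_def sandwich_index[of A d e] intro!: sum.cong)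
  also have "\<dots> = (\<Sum>k<e. \<Sum>i<d. \<Sum>l<e. A $$ (i,k) * \<rho> $$ (k,l) * cnj (A $$ (i,l)))"
    by (rule sum.swap)
  also have "\<dots> = (\<Sum>k<e. \<Sum>l<e. \<Sum>i<d. A $$ (i,k) * \<rho> $$ (k,l) * cnj (A $$ (i,l)))"
    by (rule sum.cong[OF refl sum.swap])
  also have "\<dots> = (\<Sum>k<e. \<Sum>l<e. (adj A * A) $$ (l,k) * \<rho> $$ (k,l))"
    using assms
    by (auto simp: mult_index[of "adj A" e d A e] sum_distrib_right sum_distrib_left algebra_simps intro!: sum.cong)
  finally show ?thesis .
qed

section \<open>Projectors and supports\<close>

lemma is_proj_carrier: "is_proj d P \<Longrightarrow> P \<in> carrier_mat d d"
  by (simp add: is_proj_def)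

lemma is_proj_one [simp]: "is_proj d (1\<^sub>m d)"
  by (simp add: is_proj_def)

lemma is_proj_zero [simp]: "is_proj d (0\<^sub>m d d)"
  by (simp add: is_proj_def)

lemma sandwich_one: "A \<in> carrier_mat d d \<Longrightarrow> sandwich (1\<^sub>m d) A = A"
  by (simp add: sandwich_def)

lemma is_proj_psd: "is_proj d P \<Longrightarrow> psd d P"
  using psd_sandwich[of P d d "1\<^sub>m d"] by (auto simp: is_proj_def sandwich_def)

lemma orth_carrier [simp]: "P \<in> carrier_mat d d \<Longrightarrow> orth d P \<in> carrier_mat d d"
  by (simp add: orth_def minus_carrier_mat)

lemma minus_self_mat: "A \<in> carrier_mat m n \<Longrightarrow> A - A = 0\<^sub>m m n" for A :: cmat
  by (intro eq_matI) auto

lemma mat_minus_eq_zero_iff: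
  fixes A B :: cmat
  assumes "A \<in> carrier_mat m n" "B \<in> carrier_mat m n"
  shows "A - B = 0\<^sub>m m n \<longleftrightarrow> A = B"
proof
  assume *: "A - B = 0\<^sub>m m n"
  have "A $$ (i,j) - B $$ (i,j) = 0" if "i < m" "j < n" for i j
    using arg_cong[OF *, of "\<lambda>M. M $$ (i,j)"] that assms by simp
  then show "A = B" using assms by (intro eq_matI) auto
qed (use assms in \<open>simp add: minus_self_mat\<close>)

lemma orth_mult:
  assumes "P \<in> carrier_mat d d" "A \<in> carrier_mat d d"
  shows "orth d P * A = A - P * A"
  using assms by (simp add: orth_def minus_mult_distrib_mat[of _ d d])

lemma orth_is_proj:
  assumes "is_proj d P"
  shows "is_proj d (orth d P)"
proof -
  have c: "P \<in> carrier_mat d d" using assms by (rule is_proj_carrier)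
  have "P * orth d P = 0\<^sub>m d d"
    using assms c by (simp add: orth_def mult_minus_distrib_mat[of _ d d _ d] is_proj_def minus_self_mat)
  then have "orth d P * orth d P = orth d P"
    using c by (subst orth_mult) (auto simp: orth_def)
  moreover have "adj (orth d P) = orth d P"
    using assms c by (simp add: orth_def adj_minus[of _ d d] is_proj_def)
  ultimately show ?thesis using c by (simp add: is_proj_def)
qed

lemma orth_orth: "P \<in> carrier_mat d d \<Longrightarrow> orth d (orth d P) = P"
  by (intro eq_matI) (auto simp: orth_def)

text \<open>The difference of the two sides is the trace of the complementary projector. The bound
  makes the search for a projector of maximal trace finite.\<close>

lemma proj_tr_le:
  assumes "is_proj d P"
  shows "Re (tr P) \<le> real d"
proof -
  have "tr (orth d P) = of_nat d - tr P"
    using is_proj_carrier[OF assms] by (auto simp: tr_def orth_def sum_subtractf)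
  moreover have "0 \<le> Re (tr (orth d P))"
    using psd_tr_nonneg[OF is_proj_psd[OF orth_is_proj[OF assms]]] .
  ultimately show ?thesis by simp
qed

lemma mat_eq_by_mult_vec:
  fixes A B :: cmat
  assumes "A \<in> carrier_mat d d" "B \<in> carrier_mat d d"
    and "\<And>v. v \<in> carrier_vec d \<Longrightarrow> A *\<^sub>v v = B *\<^sub>v v"
  shows "A = B"
proof (rule eq_matI)
  fix i j assume ij: "i < dim_row B" "j < dim_col B"
  have "M $$ (i,j) = (M *\<^sub>v unit_vec d j) $ i" if "M \<in> carrier_mat d d" for M :: cmat
    using that ij assms by (simp add: index_mult_mat_vec)
  then show "A $$ (i,j) = B $$ (i,j)" using assms by simp
qed (use assms in auto)

lemma range_op_proj_iff:
  assumes "is_proj d P"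
  shows "v \<in> range_op d P \<longleftrightarrow> v \<in> carrier_vec d \<and> P *\<^sub>v v = v"
proof -
  have P: "P \<in> carrier_mat d d" "P * P = P" using assms by (auto simp: is_proj_def)
  have "P *\<^sub>v (P *\<^sub>v w) = P *\<^sub>v w" if "w \<in> carrier_vec d" for w
    using assoc_mult_mat_vec[OF P(1) P(1) that] P(2) by simp
  moreover have "P *\<^sub>v w \<in> carrier_vec d" if "w \<in> carrier_vec d" for w
    using P(1) that by (rule mult_mat_vec_carrier)
  ultimately show ?thesis unfolding range_op_def mem_Collect_eq by metis
qed

lemma models_iff_mult:
  assumes "is_proj d P" "A \<in> carrier_mat d d"
  shows "models d A P \<longleftrightarrow> P * A = A"
proof -
  have P: "P \<in> carrier_mat d d" using assms(1) by (rule is_proj_carrier)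
  have "models d A P \<longleftrightarrow> (\<forall>w\<in>carrier_vec d. P *\<^sub>v (A *\<^sub>v w) = A *\<^sub>v w)"
    using mult_mat_vec_carrier[OF assms(2)]
    unfolding models_def subset_iff range_op_proj_iff[OF assms(1)] by (simp add: range_op_def) blast
  also have "\<dots> \<longleftrightarrow> (\<forall>w\<in>carrier_vec d. (P * A) *\<^sub>v w = A *\<^sub>v w)"
    using P assms(2) by (simp add: assoc_mult_mat_vec[of P d d A d])
  also have "\<dots> \<longleftrightarrow> P * A = A"
    using mat_eq_by_mult_vec[OF mult_carrier_mat[OF P assms(2)] assms(2)] by metis
  finally show ?thesis .
qed

lemma models_trans: "models d A P \<Longrightarrow> models d P Q \<Longrightarrow> models d A Q"
  by (auto simp: models_def)

lemma proj_le_eq_models: "proj_le d P Q \<longleftrightarrow> models d P Q"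
  by (simp add: proj_le_def models_def)

lemma models_sandwich:
  assumes "is_proj d P" "A \<in> carrier_mat d d"
  shows "models d (sandwich P A) P"
proof -
  have P: "P \<in> carrier_mat d d" "P * P = P" using assms(1) by (auto simp: is_proj_def)
  have "P * (P * A * adj P) = P * (P * A) * adj P"
    using P(1) assms(2) by (intro assoc_mult_mat[symmetric]) auto
  also have "P * (P * A) = P * P * A" by (rule assoc_mult_mat[symmetric, OF P(1) P(1) assms(2)])
  finally have "P * (P * A * adj P) = P * A * adj P" unfolding P(2) .
  then show ?thesis
    using models_iff_mult[OF assms(1) sandwich_carrier[OF P(1) assms(2)]] by (simp add: sandwich_def)
qed

lemma sandwich_eq_self:
  assumes P: "is_proj d P" and A: "psd d A" "models d A P"
  shows "sandwich P A = A"
proof -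
  have c: "P \<in> carrier_mat d d" "A \<in> carrier_mat d d"
    using is_proj_carrier[OF P] psd_carrier[OF A(1)] by auto
  have PA: "P * A = A" using models_iff_mult[OF P c(2)] A(2) by simp
  have "A * adj P = adj (P * A)" unfolding adj_mult[OF c] psd_hermitian[OF A(1)] ..
  then show ?thesis unfolding sandwich_def PA using psd_hermitian[OF A(1)] by simp
qed

text \<open>If the compression of A to the complement of Q vanishes, every vector of that complement
  is isotropic for A and hence annihilated by A; taking adjoints turns this into
  \<open>Q * A = A\<close>.\<close>

lemma models_iff_sandwich_orth:
  assumes Q: "is_proj d Q" and A: "psd d A"
  shows "models d A Q \<longleftrightarrow> sandwich (orth d Q) A = 0\<^sub>m d d"
proof
  have c: "Q \<in> carrier_mat d d" "A \<in> carrier_mat d d" "orth d Q \<in> carrier_mat d d"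
    using is_proj_carrier[OF Q] psd_carrier[OF A] by auto
  {
    assume "models d A Q"
    then have "orth d Q * A = 0\<^sub>m d d"
      using models_iff_mult[OF Q c(2)] c by (simp add: orth_mult minus_self_mat)
    then show "sandwich (orth d Q) A = 0\<^sub>m d d"
      using c left_mult_zero_mat[OF adj_carrier[OF c(3)]] by (simp add: sandwich_def)
  next
    assume *: "sandwich (orth d Q) A = 0\<^sub>m d d"
    have "A * adj (orth d Q) = 0\<^sub>m d d"
    proof (rule eq_matI)
      fix i j assume "i < dim_row (0\<^sub>m d d :: cmat)" "j < dim_col (0\<^sub>m d d :: cmat)"
      then have ij: "i < d" "j < d" by auto
      let ?e = "\<lambda>j k. if k = j then 1 else 0 :: complex"
      \<comment> \<open>This is \<open>adj (orth d Q)\<close> applied to the basis vector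
        \<open>e_j\<close>; pairing it with \<open>e_i\<close> reads off one entry of the product to
        be shown zero.\<close>
      let ?w = "\<lambda>k. \<Sum>l<d. cnj (orth d Q $$ (l,k)) * ?e j l"
      have w: "?w k = cnj (orth d Q $$ (j,k))" for k
      proof -
        have "?w k = (\<Sum>l<d. if l = j then cnj (orth d Q $$ (l,k)) else 0)"
          by (intro sum.cong) auto
        then show ?thesis using ij by simp
      qed
      have "bform d A ?w ?w = 0"
        using bform_sandwich[OF c(3,2), of "?e j" "?e j"] * by (simp add: bform_def)
      then have "bform d A (?e i) ?w = 0" using psd_null_vector[OF A, of ?w] by simp
      then have "(\<Sum>k<d. A $$ (i,k) * cnj (orth d Q $$ (j,k))) = 0"
        using ij by (simp add: bform_delta w)
      then show "(A * adj (orth d Q)) $$ (i,j) = 0\<^sub>m d d $$ (i,j)"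
        using ij c carrier_matD[OF c(3)] by (simp add: mult_index[of A d d _ d])
    qed (use carrier_matD[OF c(3)] carrier_matD[OF c(2)] in simp_all)
    then have "adj (adj (orth d Q)) * adj A = 0\<^sub>m d d"
      unfolding adj_mult[OF c(2) adj_carrier[OF c(3)], symmetric] by simp
    then have "A - Q * A = 0\<^sub>m d d"
      using psd_hermitian[OF A] orth_mult[OF c(1,2)] by simp
    then have "Q * A = A"
      using mat_minus_eq_zero_iff[OF c(2) mult_carrier_mat[OF c(1,2)]] by metis
    then show "models d A Q" using models_iff_mult[OF Q c(2)] by blast
  }
qed

lemma psd_add_eq_zero:
  assumes "psd d A" "psd d B"
  shows "A + B = 0\<^sub>m d d \<longleftrightarrow> A = 0\<^sub>m d d \<and> B = 0\<^sub>m d d"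
proof
  assume "A + B = 0\<^sub>m d d"
  then have "Re (tr A) + Re (tr B) = 0"
    using tr_add[OF assms[THEN psd_carrier]] plus_complex.sel(1)[of "tr A" "tr B"]
    by (simp add: tr_def[of "0\<^sub>m d d"])
  then have "Re (tr A) = 0" "Re (tr B) = 0"
    using psd_tr_nonneg[OF assms(1)] psd_tr_nonneg[OF assms(2)] by linarith+
  then show "A = 0\<^sub>m d d \<and> B = 0\<^sub>m d d" using psd_tr_zero assms by blast
qed auto

text \<open>The compression to the complement of Q is additive, and a sum of psd matrices vanishes
  only if both do. Read from left to right this is monotonicity: whatever lies below a state
  supported in Q is supported in Q.\<close>

lemma models_add_iff:
  assumes "is_proj d Q" "psd d A" "psd d B"
  shows "models d (A + B) Q \<longleftrightarrow> models d A Q \<and> models d B Q"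
  using assms psd_carrier[OF assms(2)] psd_carrier[OF assms(3)] is_proj_carrier[OF assms(1)]
  by (simp add: models_iff_sandwich_orth psd_add sandwich_add[of _ d d] psd_add_eq_zero psd_sandwich[of _ d d])

lemma models_smult_iff:
  assumes "is_proj d Q" "psd d A" "0 < c"
  shows "models d (complex_of_real c \<cdot>\<^sub>m A) Q \<longleftrightarrow> models d A Q"
proof -
  have c: "A \<in> carrier_mat d d" "Q \<in> carrier_mat d d"
    using psd_carrier[OF assms(2)] is_proj_carrier[OF assms(1)] by auto
  have "c \<cdot>\<^sub>m B = 0\<^sub>m d d \<longleftrightarrow> B = 0\<^sub>m d d" if "B \<in> carrier_mat d d" for B :: cmat
    using that assms(3) by (auto simp: mat_eq_iff)
  then show ?thesis
    using assms c sandwich_carrier[OF orth_carrier[OF c(2)] c(1)]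
    by (simp add: models_iff_sandwich_orth psd_smult sandwich_smult[of _ d d])
qed

lemma models_zero [simp]: "is_proj d Q \<Longrightarrow> models d (0\<^sub>m d d) Q"
  using is_proj_carrier[of d Q] by (simp add: models_iff_mult)

lemma models_one [simp]: "A \<in> carrier_mat d d \<Longrightarrow> models d A (1\<^sub>m d)"
  by (simp add: models_iff_mult)

text \<open>Each projector fixes the other, and the two identities are adjoints of each other up to
  the choice of P or Q on the right.\<close>

lemma models_antisym:
  assumes "is_proj d P" "is_proj d Q" "models d P Q" "models d Q P"
  shows "P = Q"
proof -
  have c: "P \<in> carrier_mat d d" "Q \<in> carrier_mat d d" using assms is_proj_carrier by auto
  have "Q * P = P" "P * Q = Q" using models_iff_mult assms c by auto
  then show ?thesis using adj_mult[OF c] assms(1,2) by (simp add: is_proj_def)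
qed

section \<open>Rank-one operators and projectors onto subspaces\<close>

definition outer :: "nat \<Rightarrow> complex vec \<Rightarrow> cmat" where
  "outer d v = sandwich (Matrix.mat d 1 (\<lambda>(i,_). v $ i)) (1\<^sub>m 1)"

lemma outer_carrier [simp]: "outer d v \<in> carrier_mat d d"
  unfolding outer_def by (rule sandwich_carrier[of _ d 1]) auto

lemma outer_dim [simp]: "dim_row (outer d v) = d" "dim_col (outer d v) = d"
  by (simp_all add: outer_def)

lemma outer_index [simp]: "i < d \<Longrightarrow> j < d \<Longrightarrow> outer d v $$ (i,j) = v $ i * cnj (v $ j)"
  by (simp add: outer_def sandwich_index[of _ d 1])

text \<open>Positivity is immediate because \<open>outer\<close> is encoded as the conjugation of a
  1 by 1 identity by the column v.\<close>

lemma psd_outer [simp]: "psd d (outer d v)"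
  unfolding outer_def by (rule psd_sandwich[of _ d 1]) auto

lemma outer_zero [simp]: "outer d (0\<^sub>v d) = 0\<^sub>m d d"
  by (intro eq_matI) auto

lemma outer_smult:
  assumes "v \<in> carrier_vec d"
  shows "outer d (c \<cdot>\<^sub>v v) = complex_of_real ((cmod c)\<^sup>2) \<cdot>\<^sub>m outer d v"
  unfolding cnj_mult_self[symmetric] using assms by (intro eq_matI) auto

lemma outer_parallelogram:
  assumes "u \<in> carrier_vec d" "v \<in> carrier_vec d"
  shows "outer d (u + v) + outer d (u - v) = 2 \<cdot>\<^sub>m outer d u + 2 \<cdot>\<^sub>m outer d v"
  using assms by (intro eq_matI) (auto simp: algebra_simps)

lemma adj_outer: "adj (outer d v) = outer d v"
  by (rule psd_hermitian[of d]) simp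

lemma mult_outer_index:
  assumes "P \<in> carrier_mat d d" "v \<in> carrier_vec d" "i < d" "j < d"
  shows "(P * outer d v) $$ (i,j) = (P *\<^sub>v v) $ i * cnj (v $ j)"
  using assms by (simp add: mult_index[of _ d d _ d] mult_vec_index[of _ d d] sum_distrib_right mult.assoc)

lemma outer_mult_vec:
  assumes "v \<in> carrier_vec d" "w \<in> carrier_vec d"
  shows "outer d v *\<^sub>v w = (\<Sum>k<d. cnj (v $ k) * w $ k) \<cdot>\<^sub>v v"
  using assms by (intro eq_vecI) (auto simp: mult_vec_index[of _ d d] sum_distrib_left sum_distrib_right mult.commute mult.left_commute)

lemma models_outer:
  assumes "is_proj d P" "v \<in> range_op d P"
  shows "models d (outer d v) P"
proof -
  have "v \<in> carrier_vec d" "P *\<^sub>v v = v" using assms range_op_proj_iff by auto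
  then have "P * outer d v = outer d v"
    using is_proj_carrier[OF assms(1)] by (intro eq_matI) (auto simp: mult_outer_index)
  then show ?thesis using assms(1) by (simp add: models_iff_mult)
qed

lemma proj_add_outer:
  assumes P: "is_proj d P" and w: "w \<in> carrier_vec d" "P *\<^sub>v w = 0\<^sub>v d"
    and norm: "(\<Sum>k<d. cnj (w $ k) * w $ k) = 1"
  shows "is_proj d (P + outer d w)"
proof -
  have c: "P \<in> carrier_mat d d" using P by (rule is_proj_carrier)
  have Pw: "P * outer d w = 0\<^sub>m d d"
    using c w by (intro eq_matI) (auto simp: mult_outer_index)
  then have wP: "outer d w * P = 0\<^sub>m d d"
    using P c adj_mult[OF c outer_carrier[of d w]] by (simp add: adj_outer is_proj_def)
  have "outer d w *\<^sub>v w = w" using w norm by (simp add: outer_mult_vec)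
  then have ww: "outer d w * outer d w = outer d w"
    using w by (intro eq_matI) (auto simp: mult_outer_index)
  have "(P + outer d w) * (P + outer d w) = P + outer d w"
    using c P Pw wP ww
    by (simp add: add_mult_distrib_mat[of _ d d _ _ d] mult_add_distrib_mat[of _ d d _ d] is_proj_def)
  moreover have "adj (P + outer d w) = P + outer d w"
    using c P by (simp add: adj_add[of _ d d] adj_outer is_proj_def)
  ultimately show ?thesis using c by (simp add: is_proj_def)
qed

text \<open>A projector of maximal trace among those with range inside \<open>W\<close> has range exactly \<open>W\<close>.
  The invariant \<open>\<Phi>\<close> stands in for a decomposition of the projector into rank-one summands.\<close>

lemma projector_onto_subspace:
  assumes W: "W \<subseteq> carrier_vec d" "0\<^sub>v d \<in> W"
    and W_add: "\<And>u v. u \<in> W \<Longrightarrow> v \<in> W \<Longrightarrow> u + v \<in> W"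
    and W_smult: "\<And>c v. v \<in> W \<Longrightarrow> c \<cdot>\<^sub>v v \<in> W"
    and \<Phi>_zero: "\<Phi> (0\<^sub>m d d)"
    and \<Phi>_step: "\<And>P v. is_proj d P \<Longrightarrow> \<Phi> P \<Longrightarrow> v \<in> W \<Longrightarrow> \<Phi> (P + outer d v)"
  shows "\<exists>P. is_proj d P \<and> range_op d P = W \<and> \<Phi> P"
proof -
  define T where "T k \<longleftrightarrow> (\<exists>P. is_proj d P \<and> range_op d P \<subseteq> W \<and> \<Phi> P \<and> tr P = of_nat k)" for k :: nat
  have "T 0" unfolding T_def
  proof (intro exI conjI)
    show "range_op d (0\<^sub>m d d) \<subseteq> W" proof -
      have "0\<^sub>m d d *\<^sub>v w = 0\<^sub>v d" if "w \<in> carrier_vec d" for w :: "complex vec"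
        using that by (intro eq_vecI) (auto simp: index_mult_mat_vec)
      then show ?thesis using W(2) by (auto simp: range_op_def)
    qed
    show "tr (0\<^sub>m d d) = of_nat 0" by (simp add: tr_def)
  qed (use \<Phi>_zero in auto)
  moreover have "k \<le> d" if "T k" for k
    using that proj_tr_le unfolding T_def by fastforce
  ultimately obtain k where k: "T k" "\<And>j. T j \<Longrightarrow> j \<le> k"
    using GreatestI_nat[of T 0 d] Greatest_le_nat[of T _ d] by blast
  then obtain P where P: "is_proj d P" "range_op d P \<subseteq> W" "\<Phi> P" "tr P = of_nat k"
    unfolding T_def by blast
  have c: "P \<in> carrier_mat d d" using P(1) by (rule is_proj_carrier)
  have "u \<in> range_op d P" if u: "u \<in> W" for u
  proof (rule ccontr)
    assume nr: "u \<notin> range_op d P"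
    have uc: "u \<in> carrier_vec d" using u W by auto
    \<comment> \<open>The component of u orthogonal to the range of P; it stays in W because W
      contains u and \<open>P u\<close> and is closed under linear combinations.\<close>
    define v where "v = u + (-1) \<cdot>\<^sub>v (P *\<^sub>v u)"
    have Pu: "P *\<^sub>v u \<in> range_op d P" using uc by (auto simp: range_op_def)
    have vc: "v \<in> carrier_vec d" using uc c by (simp add: v_def)
    have vW: "v \<in> W" unfolding v_def using u Pu P(2) W_add W_smult by blast
    have Pv: "P *\<^sub>v v = 0\<^sub>v d"
    proof -
      have "P *\<^sub>v (P *\<^sub>v u) = P *\<^sub>v u" using Pu range_op_proj_iff[OF P(1)] by blast
      then have "P *\<^sub>v v = P *\<^sub>v u + (-1) \<cdot>\<^sub>v (P *\<^sub>v u)"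
        using c uc by (simp add: v_def mult_add_distrib_mat_vec[of _ d d] mult_mat_vec[of _ d d])
      then show ?thesis using c uc by (auto intro!: eq_vecI)
    qed
    have "v \<noteq> 0\<^sub>v d"
    proof
      assume "v = 0\<^sub>v d"
      then have "u $ i - (P *\<^sub>v u) $ i = 0" if "i < d" for i
      proof -
        have "v $ i = u $ i - (P *\<^sub>v u) $ i" using that c uc by (simp add: v_def)
        then show ?thesis using \<open>v = 0\<^sub>v d\<close> that by simp
      qed
      then have "P *\<^sub>v u = u" using c uc by (intro eq_vecI) auto
      with nr uc show False using range_op_proj_iff[OF P(1)] by blast
    qed
    then obtain i where i: "i < d" "v $ i \<noteq> 0" using vc by (metis carrier_vecD eq_vecI index_zero_vec)
    define s where "s = (\<Sum>k<d. (cmod (v $ k))\<^sup>2)"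
    have "0 < s" unfolding s_def using i by (intro sum_pos2[of _ i]) auto
    \<comment> \<open>With unit length, the rank-one operator of w is a projector of trace 1
      orthogonal to P, so adding it contradicts the maximality of k.\<close>
    define w where "w = complex_of_real (1 / sqrt s) \<cdot>\<^sub>v v"
    have wW: "w \<in> W" and wc: "w \<in> carrier_vec d" unfolding w_def using vW W_smult vc by auto
    have Pw: "P *\<^sub>v w = 0\<^sub>v d" unfolding w_def using c vc Pv
      by (simp only: mult_mat_vec[of _ d d]) (auto intro!: eq_vecI)
    have "(\<Sum>k<d. cnj (w $ k) * w $ k) = of_real ((1 / sqrt s)\<^sup>2) * (\<Sum>k<d. cnj (v $ k) * v $ k)"
      using vc unfolding sum_distrib_left w_def by (intro sum.cong) (simp_all add: power2_eq_square del: real_sqrt_mult_self)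
    also have "(\<Sum>k<d. cnj (v $ k) * v $ k) = of_real s"
      unfolding s_def cnj_mult_self by simp
    also have "of_real ((1 / sqrt s)\<^sup>2) * complex_of_real s = of_real ((1 / sqrt s)\<^sup>2 * s)"
      by (rule of_real_mult[symmetric])
    also have "(1 / sqrt s)\<^sup>2 * s = 1"
      using \<open>0 < s\<close> by (simp add: power_divide)
    finally have norm: "(\<Sum>k<d. cnj (w $ k) * w $ k) = 1" by simp
    have "T (Suc k)" unfolding T_def
    proof (intro exI conjI)
      show "is_proj d (P + outer d w)" using proj_add_outer[OF P(1) wc Pw norm] .
      show "\<Phi> (P + outer d w)" using \<Phi>_step P(1,3) wW by blast
      have "tr (outer d w) = 1" using norm by (simp add: tr_def mult.commute)
      then show "tr (P + outer d w) = of_nat (Suc k)" using tr_add[OF c outer_carrier] P(4) by simp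
      show "range_op d (P + outer d w) \<subseteq> W"
      proof
        fix y assume "y \<in> range_op d (P + outer d w)"
        then obtain x where x: "x \<in> carrier_vec d" "y = (P + outer d w) *\<^sub>v x" by (auto simp: range_op_def)
        then have "y = P *\<^sub>v x + (\<Sum>k<d. cnj (w $ k) * x $ k) \<cdot>\<^sub>v w"
          using c wc by (simp add: add_mult_distrib_mat_vec[of _ d d] outer_mult_vec)
        moreover have "P *\<^sub>v x \<in> W" using P(2) x by (auto simp: range_op_def)
        ultimately show "y \<in> W" using W_add W_smult wW by blast
      qed
    qed
    then show False using k(2) by fastforce
  qed
  then show ?thesis using P by blast
qed

text \<open>A large multiple of the identity dominates \<rho>. Compressing the difference by P keeps
  it psd and leaves \<open>r P - \<rho>\<close>, since \<rho> is unchanged by the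
  compression.\<close>

lemma psd_le_proj:
  assumes P: "is_proj d P" and \<rho>: "psd d \<rho>" "models d \<rho> P"
  shows "\<exists>c \<sigma>. 0 < c \<and> psd d \<sigma> \<and> complex_of_real c \<cdot>\<^sub>m P = \<rho> + \<sigma>"
proof -
  have c: "P \<in> carrier_mat d d" "\<rho> \<in> carrier_mat d d"
    using is_proj_carrier[OF P] psd_carrier[OF \<rho>(1)] .
  \<comment> \<open>A crude norm bound: each product of two coordinate moduli is at most the squared
    length of v. The extra 1 keeps r positive when \<rho> is zero.\<close>
  define r where "r = 1 + (\<Sum>i<d. \<Sum>j<d. cmod (\<rho> $$ (i,j)))"
  have "0 < r" unfolding r_def by (intro add_pos_nonneg sum_nonneg) auto
  let ?\<tau> = "complex_of_real r \<cdot>\<^sub>m 1\<^sub>m d + (-1) \<cdot>\<^sub>m \<rho>"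
  have \<tau>: "?\<tau> \<in> carrier_mat d d" using c by simp
  have "psd d ?\<tau>" unfolding psd_iff_bform
  proof (intro conjI allI \<tau>)
    fix v :: "nat \<Rightarrow> complex"
    let ?s = "\<Sum>i<d. (cmod (v i))\<^sup>2"
    have eq: "bform d ?\<tau> v v = of_real (r * ?s) - bform d \<rho> v v"
      using c by (simp add: bform_add bform_smult bform_one cnj_mult_self)
    have sq: "cmod (v i) * cmod (v j) \<le> ?s" if "i < d" "j < d" for i j
    proof -
      have *: "(cmod (v i))\<^sup>2 \<le> ?s" if "i < d" for i using that by (intro member_le_sum) auto
      have "2 * (cmod (v i) * cmod (v j)) \<le> (cmod (v i))\<^sup>2 + (cmod (v j))\<^sup>2"
        using sum_squares_bound[of "cmod (v i)" "cmod (v j)"] by (simp add: mult.assoc)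
      then show ?thesis using *[OF that(1)] *[OF that(2)] by linarith
    qed
    have "Re (bform d \<rho> v v) \<le> cmod (bform d \<rho> v v)" by (rule complex_Re_le_cmod)
    also have "\<dots> \<le> (\<Sum>i<d. \<Sum>j<d. cmod (\<rho> $$ (i,j)) * (cmod (v i) * cmod (v j)))"
      unfolding bform_def by (intro order_trans[OF norm_sum] sum_mono) (simp add: norm_mult)
    also have "\<dots> \<le> (\<Sum>i<d. \<Sum>j<d. cmod (\<rho> $$ (i,j)) * ?s)"
      using sq by (intro sum_mono mult_left_mono) auto
    also have "\<dots> = (r - 1) * ?s" by (simp add: r_def sum_distrib_right)
    also have "\<dots> \<le> r * ?s" by (intro mult_right_mono sum_nonneg) auto
    finally show "0 \<le> Re (bform d ?\<tau> v v)" unfolding eq by simp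
    show "Im (bform d ?\<tau> v v) = 0" unfolding eq using psdD(1)[OF \<rho>(1)] by simp
  qed
  then have psd: "psd d (sandwich P ?\<tau>)" using c by (rule_tac psd_sandwich)
  have "sandwich P (1\<^sub>m d) = P" using P c by (simp add: sandwich_def is_proj_def)
  then have eq: "sandwich P ?\<tau> = complex_of_real r \<cdot>\<^sub>m P + (-1) \<cdot>\<^sub>m \<rho>"
    using c sandwich_eq_self[OF P \<rho>] by (simp add: sandwich_add[of _ d d] sandwich_smult[of _ d d])
  have "complex_of_real r \<cdot>\<^sub>m P = \<rho> + sandwich P ?\<tau>"
    unfolding eq using c by (intro eq_matI) simp_all
  with \<open>0 < r\<close> psd show ?thesis by (intro exI[of _ r] exI[of _ "sandwich P ?\<tau>"] conjI)
qed

section \<open>Linear positive maps and program correctness\<close>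

text \<open>Linearity is only demanded on the psd cone: the while semantics is an entrywise series
  whose convergence is guaranteed there only.\<close>

definition cone_op :: "nat \<Rightarrow> superop \<Rightarrow> bool" where
  "cone_op d E \<longleftrightarrow>
     (\<forall>\<rho>. psd d \<rho> \<longrightarrow> psd d (E \<rho>) \<and> Re (tr (E \<rho>)) \<le> Re (tr \<rho>)) \<and>
     (\<forall>\<rho> \<sigma>. psd d \<rho> \<longrightarrow> psd d \<sigma> \<longrightarrow> E (\<rho> + \<sigma>) = E \<rho> + E \<sigma>) \<and>
     (\<forall>\<rho> c. psd d \<rho> \<longrightarrow> 0 \<le> c \<longrightarrow> E (complex_of_real c \<cdot>\<^sub>m \<rho>) = complex_of_real c \<cdot>\<^sub>m E \<rho>)"

lemma cone_opD:
  assumes "cone_op d E"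
  shows "psd d \<rho> \<Longrightarrow> psd d (E \<rho>)"
    and "psd d \<rho> \<Longrightarrow> Re (tr (E \<rho>)) \<le> Re (tr \<rho>)"
    and "psd d \<rho> \<Longrightarrow> psd d \<sigma> \<Longrightarrow> E (\<rho> + \<sigma>) = E \<rho> + E \<sigma>"
    and "psd d \<rho> \<Longrightarrow> 0 \<le> c \<Longrightarrow> E (complex_of_real c \<cdot>\<^sub>m \<rho>) = complex_of_real c \<cdot>\<^sub>m E \<rho>"
  using assms by (auto simp: cone_op_def)

lemma cone_op_carrier: "cone_op d E \<Longrightarrow> psd d \<rho> \<Longrightarrow> E \<rho> \<in> carrier_mat d d"
  by (rule psd_carrier[OF cone_opD(1)])

lemma zero_smult_mat: "A \<in> carrier_mat m n \<Longrightarrow> 0 \<cdot>\<^sub>m A = 0\<^sub>m m n" for A :: cmat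
  by (intro eq_matI) auto

lemma cone_op_zero:
  assumes "cone_op d E"
  shows "E (0\<^sub>m d d) = 0\<^sub>m d d"
  using cone_opD(4)[OF assms psd_zero, of 0] cone_op_carrier[OF assms psd_zero]
  by (simp add: zero_smult_mat)

lemma cone_op_comp:
  assumes "cone_op d E" "cone_op d F"
  shows "cone_op d (\<lambda>\<rho>. F (E \<rho>))"
  unfolding cone_op_def using cone_opD[OF assms(1)] cone_opD[OF assms(2)] order_trans by metis

lemma cone_op_sandwich:
  assumes A: "A \<in> carrier_mat d d" and tr: "\<And>\<rho>. psd d \<rho> \<Longrightarrow> Re (tr (sandwich A \<rho>)) \<le> Re (tr \<rho>)"
  shows "cone_op d (sandwich A)"
  unfolding cone_op_def
  using tr psd_sandwich[OF A] sandwich_add[OF A] sandwich_smult[OF A] psd_carrier by blast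

lemma cone_op_models_add_iff:
  assumes "cone_op d E" "is_proj d Q" "psd d \<rho>" "psd d \<sigma>"
  shows "models d (E (\<rho> + \<sigma>)) Q \<longleftrightarrow> models d (E \<rho>) Q \<and> models d (E \<sigma>) Q"
  using cone_opD[OF assms(1)] assms models_add_iff by metis

lemma cone_op_models_smult_iff:
  assumes "cone_op d E" "is_proj d Q" "psd d \<rho>" "0 < c"
  shows "models d (E (complex_of_real c \<cdot>\<^sub>m \<rho>)) Q \<longleftrightarrow> models d (E \<rho>) Q"
  using cone_opD(4)[OF assms(1,3), of c] models_smult_iff[OF assms(2) cone_opD(1)[OF assms(1,3)] assms(4)] assms(4)
  by simp

text \<open>The off-diagonal blocks of \<open>\<rho>\<close> are dominated by its diagonal blocks, hence do not contribute to
  the support of \<open>F \<rho>\<close> when \<open>F\<close> kills one of the latter.\<close>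

lemma cone_op_models_sandwich_iff:
  assumes F: "cone_op d F" and P: "is_proj d P" and T: "is_proj d T" and \<rho>: "psd d \<rho>"
    and null: "F (sandwich (orth d P) \<rho>) = 0\<^sub>m d d"
  shows "models d (F (sandwich P \<rho>)) T \<longleftrightarrow> models d (F \<rho>) T"
proof -
  let ?P' = "orth d P"
  let ?\<sigma> = "sandwich ?P' \<rho>"
  have c: "P \<in> carrier_mat d d" "?P' \<in> carrier_mat d d" "\<rho> \<in> carrier_mat d d"
    using is_proj_carrier[OF P] psd_carrier[OF \<rho>] by auto
  have psd: "psd d (sandwich A \<rho>)" if "A \<in> carrier_mat d d" for A using that \<rho> by (rule psd_sandwich)
  \<comment> \<open>Adding the multiple of \<sigma> changes nothing because F kills \<sigma>, and
    positive factors do not affect supports.\<close>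
  have double: "models d (F (2 \<cdot>\<^sub>m \<tau> + 2 \<cdot>\<^sub>m ?\<sigma>)) T \<longleftrightarrow> models d (F \<tau>) T" if \<tau>: "psd d \<tau>" for \<tau>
  proof -
    have "models d (F (complex_of_real 2 \<cdot>\<^sub>m \<tau> + complex_of_real 2 \<cdot>\<^sub>m ?\<sigma>)) T \<longleftrightarrow>
        models d (F \<tau>) T \<and> models d (F ?\<sigma>) T"
      using cone_op_models_add_iff[OF F T psd_smult[OF \<tau>] psd_smult[OF psd[OF c(2)]], of 2 2]
        cone_op_models_smult_iff[OF F T \<tau>, of 2] cone_op_models_smult_iff[OF F T psd[OF c(2)], of 2]
      by simp
    then show ?thesis using null T by simp
  qed
  have split: "models d (F (2 \<cdot>\<^sub>m sandwich A \<rho> + 2 \<cdot>\<^sub>m ?\<sigma>)) T \<longleftrightarrow>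
      models d (F (sandwich (A + ?P') \<rho>)) T \<and> models d (F (sandwich (A - ?P') \<rho>)) T"
    if "A \<in> carrier_mat d d" for A
    unfolding sandwich_parallelogram[OF that c(2,3), symmetric]
    by (intro cone_op_models_add_iff[OF F T] psd) (use c that in \<open>auto intro: minus_carrier_mat\<close>)
  \<comment> \<open>The identity is used twice. For \<open>A = P\<close> the plus term is \<rho>
    itself, which gives one direction; for \<open>A = 1\<close> the minus term is the compression of
    \<rho> by P, which gives the other.\<close>
  have "P + ?P' = 1\<^sub>m d" "1\<^sub>m d - ?P' = P" using c by (auto simp: orth_def intro!: eq_matI)
  then have "models d (F (sandwich P \<rho>)) T \<Longrightarrow> models d (F \<rho>) T"
    "models d (F \<rho>) T \<Longrightarrow> models d (F (sandwich P \<rho>)) T"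
    using split[OF c(1)] split[OF one_carrier_mat] double[OF \<rho>] double[OF psd[OF c(1)]] c
    by (simp_all add: sandwich_one)
  then show ?thesis by blast
qed

section \<open>Strongest postconditions and weakest preconditions\<close>

lemma valid_iff_psd:
  assumes E: "\<forall>E\<in>den n S. cone_op (2^n) E" and P: "is_proj (2^n) P" and Q: "is_proj (2^n) Q"
  shows "valid n P S Q \<longleftrightarrow>
    (\<forall>E\<in>den n S. \<forall>\<rho>. psd (2^n) \<rho> \<longrightarrow> models (2^n) \<rho> P \<longrightarrow> models (2^n) (E \<rho>) Q)"
proof
  assume v: "valid n P S Q"
  show "\<forall>E\<in>den n S. \<forall>\<rho>. psd (2^n) \<rho> \<longrightarrow> models (2^n) \<rho> P \<longrightarrow> models (2^n) (E \<rho>) Q"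
  proof (intro ballI allI impI)
    fix E \<rho> assume *: "E \<in> den n S" "psd (2^n) \<rho>" "models (2^n) \<rho> P"
    \<comment> \<open>Rescaling to a partial density operator; the summand 1 in the denominator
      covers the zero state.\<close>
    define c where "c = 1 / (1 + Re (tr \<rho>))"
    have t: "0 \<le> Re (tr \<rho>)" using psd_tr_nonneg[OF *(2)] .
    then have c: "0 < c" "c * Re (tr \<rho>) \<le> 1" by (auto simp: c_def divide_simps)
    have "pdo (2^n) (complex_of_real c \<cdot>\<^sub>m \<rho>)"
      using c psd_smult[OF *(2), of c] by (simp add: pdo_def tr_smult[OF psd_carrier[OF *(2)]])
    moreover have "models (2^n) (complex_of_real c \<cdot>\<^sub>m \<rho>) P"
      using models_smult_iff[OF P *(2) c(1)] *(3) by simp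
    ultimately have "models (2^n) (E (complex_of_real c \<cdot>\<^sub>m \<rho>)) Q"
      using v *(1) unfolding valid_def by blast
    then show "models (2^n) (E \<rho>) Q" using cone_op_models_smult_iff[OF E[rule_format, OF *(1)] Q *(2) c(1)] by simp
  qed
qed (auto simp: valid_def pdo_def)

lemma sp_least:
  assumes E: "\<forall>E\<in>den n S. cone_op (2^n) E" and P: "is_proj (2^n) P"
  shows "is_proj (2^n) (sp n S P) \<and> valid n P S (sp n S P) \<and>
    (\<forall>Q. is_proj (2^n) Q \<and> valid n P S Q \<longrightarrow> proj_le (2^n) (sp n S P) Q)"
proof -
  let ?d = "2^n"
  let ?V = "{Q. is_proj ?d Q \<and> valid n P S Q}"
  define W where "W = (\<Inter>Q\<in>?V. range_op ?d Q)"
  have W_iff: "v \<in> W \<longleftrightarrow> (\<forall>Q\<in>?V. v \<in> carrier_vec ?d \<and> Q *\<^sub>v v = v)" for v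
    unfolding W_def using range_op_proj_iff by blast
  \<comment> \<open>The full space is a valid postcondition, so the intersection W is taken over a
    nonempty family and consists of vectors of the right dimension.\<close>
  have one: "1\<^sub>m ?d \<in> ?V"
    using cone_op_carrier[OF E[rule_format]] valid_iff_psd[OF E P is_proj_one] by simp
  \<comment> \<open>No invariant has to be carried along here, hence the trivial \<open>True\<close>
    in its place.\<close>
  have "\<exists>R. is_proj ?d R \<and> range_op ?d R = W \<and> True"
  proof (rule projector_onto_subspace)
    show "W \<subseteq> carrier_vec ?d" using one W_iff by blast
    show "0\<^sub>v ?d \<in> W" unfolding W_iff
      by (auto simp: index_mult_mat_vec dest!: is_proj_carrier intro!: eq_vecI)
    show "u + v \<in> W" if "u \<in> W" "v \<in> W" for u v
      using that mult_add_distrib_mat_vec[of _ ?d ?d u v] is_proj_carrier unfolding W_iff by auto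
    show "c \<cdot>\<^sub>v v \<in> W" if "v \<in> W" for c v
      using that mult_mat_vec[of _ ?d ?d v c] is_proj_carrier unfolding W_iff by auto
  qed auto
  then obtain R where R: "is_proj ?d R" "range_op ?d R = W" by blast
  have Rv: "valid n P S R" using R(2) unfolding valid_def models_def W_def by blast
  have least: "proj_le ?d R Q" if "is_proj ?d Q" "valid n P S Q" for Q
    using that R(2) unfolding proj_le_def W_def by blast
  show ?thesis unfolding sp_def
  proof (rule theI2[of _ R])
    fix Q assume "is_proj ?d Q \<and> valid n P S Q \<and> (\<forall>Q'. is_proj ?d Q' \<and> valid n P S Q' \<longrightarrow> proj_le ?d Q Q')"
    then show "Q = R" using models_antisym R Rv least unfolding proj_le_eq_models by blast
  qed (use R Rv least in auto)
qed

lemma wlp_greatest: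
  assumes E: "\<forall>E\<in>den n S. cone_op (2^n) E" and Q: "is_proj (2^n) Q"
  shows "is_proj (2^n) (wlp n S Q) \<and> valid n (wlp n S Q) S Q \<and>
    (\<forall>P. is_proj (2^n) P \<and> valid n P S Q \<longrightarrow> proj_le (2^n) P (wlp n S Q))"
proof -
  let ?d = "2^n :: nat"
  define W where "W = {v \<in> carrier_vec ?d. \<forall>E\<in>den n S. models ?d (E (outer ?d v)) Q}"
  \<comment> \<open>This invariant survives the addition of a rank-one operator of a vector in W, so
    in the end R itself, as an unnormalised state, is sent into Q.\<close>
  define \<Phi> where "\<Phi> P \<longleftrightarrow> psd ?d P \<and> (\<forall>E\<in>den n S. models ?d (E P) Q)" for P
  have \<Phi>0: "\<Phi> (0\<^sub>m ?d ?d)" unfolding \<Phi>_def by (simp add: cone_op_zero[OF E[rule_format]] Q)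
  have "\<exists>R. is_proj ?d R \<and> range_op ?d R = W \<and> \<Phi> R"
  proof (rule projector_onto_subspace[where \<Phi> = \<Phi>])
    show "0\<^sub>v ?d \<in> W" using \<Phi>0 by (simp add: W_def \<Phi>_def)
    show "u + v \<in> W" if "u \<in> W" "v \<in> W" for u v
    proof -
      have uv: "u \<in> carrier_vec ?d" "v \<in> carrier_vec ?d" using that by (auto simp: W_def)
      have "models ?d (E (outer ?d (u + v))) Q" if "E \<in> den n S" for E
      proof -
        \<comment> \<open>By the parallelogram identity the rank-one state of \<open>u + v\<close>
          is a summand of a positive combination of the states of u and v, which are sent into
          Q.\<close>
        have "models ?d (E (complex_of_real 2 \<cdot>\<^sub>m outer ?d w)) Q" if "w \<in> W" for w
          using cone_op_models_smult_iff[OF E[rule_format, OF \<open>E \<in> den n S\<close>] Q psd_outer, of 2] that \<open>E \<in> den n S\<close>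
          unfolding W_def by simp
        then have "models ?d (E (outer ?d (u + v) + outer ?d (u - v))) Q"
          unfolding outer_parallelogram[OF uv]
          using cone_op_models_add_iff[OF E[rule_format, OF \<open>E \<in> den n S\<close>] Q psd_smult[OF psd_outer, of 2]
              psd_smult[OF psd_outer, of 2], of u v] \<open>u \<in> W\<close> \<open>v \<in> W\<close> by simp
        then show ?thesis
          using cone_op_models_add_iff[OF E[rule_format, OF \<open>E \<in> den n S\<close>] Q psd_outer psd_outer] by blast
      qed
      then show ?thesis using uv by (simp add: W_def)
    qed
    show "c \<cdot>\<^sub>v v \<in> W" if "v \<in> W" for c v
    proof -
      have "models ?d (E (outer ?d (c \<cdot>\<^sub>v v))) Q" if "E \<in> den n S" for E
      proof (cases "c = 0")
        case True
        then have "c \<cdot>\<^sub>v v = 0\<^sub>v ?d" using \<open>v \<in> W\<close> by (auto simp: W_def)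
        then show ?thesis using \<Phi>0 that by (simp add: \<Phi>_def)
      next
        case False
        then show ?thesis
          using \<open>v \<in> W\<close> that cone_op_models_smult_iff[OF E[rule_format, OF that] Q psd_outer, of "(cmod c)\<^sup>2" v] outer_smult[of v ?d c]
          by (simp add: W_def)
      qed
      then show ?thesis using that by (simp add: W_def)
    qed
    show "\<Phi> (P + outer ?d v)" if "\<Phi> P" "v \<in> W" for P v
      using that psd_add[OF _ psd_outer] cone_op_models_add_iff[OF E[rule_format] Q _ psd_outer]
      by (simp add: \<Phi>_def W_def)
  qed (use \<Phi>0 in \<open>auto simp: W_def\<close>)
  then obtain R where R: "is_proj ?d R" "range_op ?d R = W" "\<Phi> R" by blast
  have Rv: "valid n R S Q" unfolding valid_iff_psd[OF E R(1) Q]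
  proof (intro ballI allI impI)
    fix E \<rho> assume *: "E \<in> den n S" "psd ?d \<rho>" "models ?d \<rho> R"
    \<comment> \<open>An arbitrary state supported in R is a summand of a multiple of R, and the
      invariant controls R.\<close>
    obtain c \<sigma> where c: "0 < c" "psd ?d \<sigma>" "complex_of_real c \<cdot>\<^sub>m R = \<rho> + \<sigma>"
      using psd_le_proj[OF R(1) *(2,3)] by blast
    have "models ?d (E (complex_of_real c \<cdot>\<^sub>m R)) Q"
      using cone_op_models_smult_iff[OF E[rule_format, OF *(1)] Q _ c(1)] R(3) *(1) by (simp add: \<Phi>_def)
    then show "models ?d (E \<rho>) Q"
      unfolding c(3) using cone_op_models_add_iff[OF E[rule_format, OF *(1)] Q *(2) c(2)] by blast
  qed
  have greatest: "proj_le ?d P R" if "is_proj ?d P" "valid n P S Q" for P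
    unfolding proj_le_def R(2) W_def
  proof (intro subsetI CollectI conjI ballI)
    fix v E assume v: "v \<in> range_op ?d P"
    then show "v \<in> carrier_vec ?d" using range_op_proj_iff[OF that(1)] by blast
    assume "E \<in> den n S"
    then show "models ?d (E (outer ?d v)) Q"
      using that models_outer[OF that(1) v] valid_iff_psd[OF E that(1) Q] by simp
  qed
  show ?thesis unfolding wlp_def
  proof (rule theI2[of _ R])
    fix P assume "is_proj ?d P \<and> valid n P S Q \<and> (\<forall>P'. is_proj ?d P' \<and> valid n P' S Q \<longrightarrow> proj_le ?d P' P)"
    then show "P = R" using models_antisym R(1) Rv greatest unfolding proj_le_eq_models by blast
  qed (use R Rv greatest in auto)
qed

text \<open>Validity is preserved by enlarging the postcondition, so the valid postconditions are
  exactly the projectors above the least one.\<close>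

lemma sp_le_iff_valid:
  assumes E: "\<forall>E\<in>den n S. cone_op (2^n) E" and P: "is_proj (2^n) P" and Q: "is_proj (2^n) Q"
  shows "proj_le (2^n) (sp n S P) Q \<longleftrightarrow> valid n P S Q"
  using sp_least[OF E P] Q models_trans unfolding proj_le_eq_models valid_def by blast

lemma le_wlp_iff_valid:
  assumes E: "\<forall>E\<in>den n S. cone_op (2^n) E" and P: "is_proj (2^n) P" and Q: "is_proj (2^n) Q"
  shows "proj_le (2^n) P (wlp n S Q) \<longleftrightarrow> valid n P S Q"
  using wlp_greatest[OF E Q] P models_trans unfolding proj_le_eq_models valid_def by blast

section \<open>Quantum registers\<close>

lemma bitv_eq_bit: "bitv i q = bit i q"
  by (simp add: bitv_def bit_iff_odd)

lemma idx_of_eq_horner_sum: "idx_of n f = horner_sum of_bool 2 (map f [0..<n])"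
  unfolding idx_of_def horner_sum_eq_sum by (intro sum.cong) (simp_all add: lessThan_atLeast0)

lemma bitv_idx_of: "q < n \<Longrightarrow> bitv (idx_of n f) q = f q"
  by (simp add: idx_of_eq_horner_sum bitv_eq_bit bit_horner_sum_bit_iff)

lemma idx_of_less [simp]: "idx_of n f < 2 ^ n"
  using horner_sum_of_bool_2_less[of "map f [0..<n]"] by (simp add: idx_of_eq_horner_sum flip: of_nat_less_iff)

lemma idx_of_bitv: "i < 2 ^ n \<Longrightarrow> idx_of n (bitv i) = i"
  using horner_sum_bit_eq_take_bit[of i n]
  by (simp add: idx_of_eq_horner_sum bitv_eq_bit[abs_def] take_bit_nat_eq_self)

lemma idx_of_cong: "(\<And>q. q < n \<Longrightarrow> f q = g q) \<Longrightarrow> idx_of n f = idx_of n g"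
  by (simp add: idx_of_def)

lemma bitv_eqI:
  assumes "i < 2 ^ n" "j < 2 ^ n" "\<And>q. q < n \<Longrightarrow> bitv i q = bitv j q"
  shows "i = j"
  using idx_of_cong[of n "bitv i" "bitv j"] assms by (simp add: idx_of_bitv)

lemma loc_eq_idx_of: "loc qs i = idx_of (length qs) (\<lambda>t. bitv i (qs ! t))"
  by (simp add: loc_def idx_of_def)

lemma loc_less [simp]: "loc qs i < 2 ^ length qs"
  by (simp add: loc_eq_idx_of)

lemma bitv_loc: "t < length qs \<Longrightarrow> bitv (loc qs i) t = bitv i (qs ! t)"
  by (simp add: loc_eq_idx_of bitv_idx_of)

lemma upd_bits_notin: "q \<notin> set qs \<Longrightarrow> upd_bits f qs a q = f q"
  by (induction f qs a rule: upd_bits.induct) auto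

text \<open>Distinctness matters because a later entry of the list would overwrite the bit written
  for an earlier one.\<close>

lemma upd_bits_nth: "distinct qs \<Longrightarrow> t < length qs \<Longrightarrow> upd_bits f qs a (qs ! t) = bitv a t"
proof (induction f qs a arbitrary: t rule: upd_bits.induct)
  case (2 f q qs a)
  show ?case
  proof (cases t)
    case 0
    then show ?thesis using 2 by (simp add: upd_bits_notin bitv_def)
  next
    case (Suc s)
    then show ?thesis using "2.IH"[of s] "2.prems" by (simp add: bitv_def div_mult2_eq fun_upd_def)
  qed
qed simp

lemma place_less [simp]: "place n qs i a < 2 ^ n"
  by (simp add: place_def)

lemma bitv_place_nth:
  assumes "reg_ok n qs" "t < length qs"
  shows "bitv (place n qs i a) (qs ! t) = bitv a t"
proof -
  have "qs ! t < n" using assms by (metis lessThan_iff nth_mem reg_ok_def subsetD)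
  then show ?thesis using assms by (simp add: place_def bitv_idx_of upd_bits_nth reg_ok_def)
qed

lemma bitv_place_notin: "q < n \<Longrightarrow> q \<notin> set qs \<Longrightarrow> bitv (place n qs i a) q = bitv i q"
  by (simp add: place_def bitv_idx_of upd_bits_notin)

lemma loc_place:
  assumes "reg_ok n qs" "a < 2 ^ length qs"
  shows "loc qs (place n qs i a) = a"
  by (rule bitv_eqI) (use assms in \<open>auto simp: bitv_loc bitv_place_nth\<close>)

text \<open>Related indices describe the same basis state of the qubits outside the register. The
  class of i is a copy of the local basis: \<open>place n qs i\<close> enumerates it and
  \<open>loc qs\<close> is the inverse. This is the tensor decomposition in terms of
  indices.\<close>

definition agree_off :: "nat \<Rightarrow> nat list \<Rightarrow> nat \<Rightarrow> nat \<Rightarrow> bool" where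
  "agree_off n qs i j \<longleftrightarrow> (\<forall>q<n. q \<notin> set qs \<longrightarrow> bitv i q = bitv j q)"

lemma agree_off_refl [simp]: "agree_off n qs i i"
  by (simp add: agree_off_def)

lemma agree_off_sym: "agree_off n qs i j \<longleftrightarrow> agree_off n qs j i"
  by (auto simp: agree_off_def)

lemma agree_off_place: "agree_off n qs (place n qs i a) j \<longleftrightarrow> agree_off n qs i j"
  by (auto simp: agree_off_def bitv_place_notin)

lemma place_cong:
  assumes "reg_ok n qs" "agree_off n qs i j"
  shows "place n qs i a = place n qs j a"
proof (rule bitv_eqI)
  fix q assume "q < n"
  then show "bitv (place n qs i a) q = bitv (place n qs j a) q"
    using assms bitv_place_nth[OF assms(1)]
    by (cases "q \<in> set qs") (auto simp: bitv_place_notin agree_off_def in_set_conv_nth)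
qed auto

lemma place_place: "reg_ok n qs \<Longrightarrow> place n qs (place n qs i a) b = place n qs i b"
  by (rule place_cong) (auto simp: agree_off_place)

lemma place_loc:
  assumes "reg_ok n qs" "i < 2 ^ n"
  shows "place n qs i (loc qs i) = i"
proof (rule bitv_eqI)
  fix q assume "q < n"
  then show "bitv (place n qs i (loc qs i)) q = bitv i q"
    using bitv_place_nth[OF assms(1)]
    by (cases "q \<in> set qs") (auto simp: bitv_place_notin in_set_conv_nth bitv_loc)
qed (use assms in auto)

lemma agree_off_loc_eq:
  assumes "reg_ok n qs" "i < 2 ^ n" "j < 2 ^ n" "agree_off n qs i j"
  shows "loc qs i = loc qs j \<longleftrightarrow> i = j"
  using place_loc[OF assms(1,2)] place_loc[OF assms(1,3)] place_cong[OF assms(1,4)] by metis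

lemma sum_agree_off:
  fixes g :: "nat \<Rightarrow> 'a :: comm_monoid_add"
  assumes "reg_ok n qs"
  shows "(\<Sum>l<2 ^ n. if agree_off n qs i l then g l else 0) = (\<Sum>a<2 ^ length qs. g (place n qs i a))"
proof -
  have "(\<Sum>l<2 ^ n. if agree_off n qs i l then g l else 0) = (\<Sum>l\<in>{l\<in>{..<2^n}. agree_off n qs i l}. g l)"
    by (rule sum.inter_filter[symmetric]) simp
  also have "\<dots> = (\<Sum>a<2 ^ length qs. g (place n qs i a))"
  proof (rule sum.reindex_bij_witness[of _ "place n qs i" "loc qs"])
    fix l assume "l \<in> {l \<in> {..<2^n}. agree_off n qs i l}"
    then show "place n qs i (loc qs l) = l" "g (place n qs i (loc qs l)) = g l"
      using place_loc[OF assms, of l] place_cong[OF assms, of i l] by auto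
  next
    fix a :: nat assume "a \<in> {..<2 ^ length qs}"
    then show "place n qs i a \<in> {l \<in> {..<2 ^ n}. agree_off n qs i l}"
      using agree_off_place[of n qs i a i] agree_off_sym by auto
  qed (use assms in \<open>auto simp: loc_place\<close>)
  finally show ?thesis .
qed

text \<open>Double counting: each index is reached exactly once from every one of the
  \<open>2 ^ length qs\<close> members of its class.\<close>

lemma sum_sum_place:
  fixes h :: "nat \<Rightarrow> 'a :: comm_semiring_1"
  assumes "reg_ok n qs"
  shows "(\<Sum>i<2 ^ n. \<Sum>a<2 ^ length qs. h (place n qs i a)) = 2 ^ length qs * (\<Sum>i<2 ^ n. h i)"
proof -
  have "(\<Sum>i<2 ^ n. \<Sum>a<2 ^ length qs. h (place n qs i a)) =
      (\<Sum>i<2 ^ n. \<Sum>l<2 ^ n. if agree_off n qs i l then h l else 0)"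
    by (simp add: sum_agree_off[OF assms])
  also have "\<dots> = (\<Sum>l<2 ^ n. \<Sum>i<2 ^ n. if agree_off n qs l i then h l else 0)"
    by (subst sum.swap) (simp add: agree_off_sym[of n qs])
  also have "\<dots> = (\<Sum>l<2 ^ n. 2 ^ length qs * h l)"
    by (simp add: sum_agree_off[OF assms])
  finally show ?thesis by (simp add: sum_distrib_left)
qed

section \<open>Operators extended from a register\<close>

lemma ext_op_carrier [simp]: "ext_op n qs A \<in> carrier_mat (2^n) (2^n)"
  by (simp add: ext_op_def)

lemma ext_op_dim [simp]: "dim_row (ext_op n qs A) = 2^n" "dim_col (ext_op n qs A) = 2^n"
  by (simp_all add: ext_op_def)

lemma ext_op_index:
  assumes "i < 2^n" "j < 2^n"
  shows "ext_op n qs A $$ (i,j) = (if agree_off n qs i j then A $$ (loc qs i, loc qs j) else 0)"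
  using assms by (simp add: ext_op_def agree_off_def)

text \<open>Nonzero terms force the intermediate index into the class of i, so the global sum
  collapses to the sum over local indices that defines the product of A and B.\<close>

lemma ext_op_mult:
  assumes qs: "reg_ok n qs"
    and AB: "A \<in> carrier_mat (2 ^ length qs) (2 ^ length qs)" "B \<in> carrier_mat (2 ^ length qs) (2 ^ length qs)"
  shows "ext_op n qs A * ext_op n qs B = ext_op n qs (A * B)"
proof (rule eq_matI)
  fix i j assume "i < dim_row (ext_op n qs (A * B))" "j < dim_col (ext_op n qs (A * B))"
  then have ij: "i < 2^n" "j < 2^n" by auto
  have "(ext_op n qs A * ext_op n qs B) $$ (i,j) = (\<Sum>l<2^n. if agree_off n qs i l
      then A $$ (loc qs i, loc qs l) * (if agree_off n qs l j then B $$ (loc qs l, loc qs j) else 0) else 0)"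
    unfolding mult_index[OF ext_op_carrier ext_op_carrier ij]
    by (intro sum.cong) (use ij in \<open>auto simp: ext_op_index\<close>)
  also have "\<dots> = (\<Sum>a<2 ^ length qs. A $$ (loc qs i, a) * (if agree_off n qs i j then B $$ (a, loc qs j) else 0))"
    unfolding sum_agree_off[OF qs] by (intro sum.cong) (auto simp: loc_place[OF qs] agree_off_place)
  also have "\<dots> = ext_op n qs (A * B) $$ (i,j)"
    using ij by (simp add: ext_op_index mult_index[OF AB loc_less loc_less])
  finally show "(ext_op n qs A * ext_op n qs B) $$ (i,j) = ext_op n qs (A * B) $$ (i,j)" .
qed auto

lemma ext_op_adj:
  assumes "A \<in> carrier_mat (2 ^ length qs) (2 ^ length qs)"
  shows "adj (ext_op n qs A) = ext_op n qs (adj A)"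
  by (rule eq_matI) (use assms in \<open>auto simp: ext_op_index agree_off_sym\<close>)

lemma ext_op_one:
  assumes "reg_ok n qs"
  shows "ext_op n qs (1\<^sub>m (2 ^ length qs)) = 1\<^sub>m (2^n)"
  by (rule eq_matI) (use agree_off_loc_eq[OF assms] in \<open>auto simp: ext_op_index\<close>)

text \<open>The denotations of \<open>If\<close> and \<open>While\<close> extend the local
  complement; this rewrites it as the complement of the extended projector, so that the global trace
  balance applies.\<close>

lemma ext_op_orth:
  assumes "reg_ok n qs" "P \<in> carrier_mat (2 ^ length qs) (2 ^ length qs)"
  shows "ext_op n qs (orth (2 ^ length qs) P) = orth (2^n) (ext_op n qs P)"
  by (rule eq_matI) (use assms(2) agree_off_loc_eq[OF assms(1)] in \<open>auto simp: ext_op_index orth_def\<close>)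

lemma ext_op_proj:
  assumes "reg_ok n qs" "is_proj (2 ^ length qs) P"
  shows "is_proj (2^n) (ext_op n qs P)"
  using assms by (simp add: is_proj_def ext_op_mult ext_op_adj)

lemma ext_op_all:
  assumes "A \<in> carrier_mat (2^n) (2^n)"
  shows "ext_op n [0..<n] A = A"
proof (rule eq_matI)
  have "loc [0..<n] i = i" if "i < 2^n" for i
    unfolding loc_eq_idx_of using idx_of_bitv[OF that] idx_of_cong[of n "\<lambda>t. bitv i ([0..<n] ! t)" "bitv i"] by simp
  then show "ext_op n [0..<n] A $$ (i,j) = A $$ (i,j)" if "i < dim_row A" "j < dim_col A" for i j
    using that assms by (simp add: ext_op_index agree_off_def)
qed (use assms in auto)

section \<open>Denotations act on the psd cone\<close>

lemma tr_eq_sum_one: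
  assumes "\<rho> \<in> carrier_mat d d"
  shows "tr \<rho> = (\<Sum>k<d. \<Sum>l<d. 1\<^sub>m d $$ (l,k) * \<rho> $$ (k,l))"
proof -
  have "(\<Sum>k<d. \<Sum>l<d. 1\<^sub>m d $$ (l,k) * \<rho> $$ (k,l)) = (\<Sum>k<d. \<Sum>l<d. if k = l then \<rho> $$ (k,l) else 0)"
    by (intro sum.cong) auto
  then show ?thesis using assms by (simp add: tr_def)
qed

lemma tr_sandwich_isometry:
  assumes "U \<in> carrier_mat d d" "adj U * U = 1\<^sub>m d" "\<rho> \<in> carrier_mat d d"
  shows "tr (sandwich U \<rho>) = tr \<rho>"
  using tr_sandwich[OF assms(1,3)] tr_eq_sum_one[OF assms(3)] assms(2) by simp

text \<open>The Gram matrices of P and its complement are these projectors themselves and add up to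
  the identity. It is the conservation of trace in a two-outcome measurement.\<close>

lemma tr_sandwich_proj_orth:
  assumes P: "is_proj d P" and \<rho>: "\<rho> \<in> carrier_mat d d"
  shows "tr (sandwich P \<rho>) + tr (sandwich (orth d P) \<rho>) = tr \<rho>"
proof -
  have c: "P \<in> carrier_mat d d" "orth d P \<in> carrier_mat d d" using is_proj_carrier[OF P] by auto
  have gram: "adj P * P = P" "adj (orth d P) * orth d P = orth d P"
    using P orth_is_proj[OF P] by (auto simp: is_proj_def)
  have "tr (sandwich P \<rho>) + tr (sandwich (orth d P) \<rho>) =
      (\<Sum>k<d. \<Sum>l<d. (P $$ (l,k) + orth d P $$ (l,k)) * \<rho> $$ (k,l))"
    unfolding tr_sandwich[OF c(1) \<rho>] tr_sandwich[OF c(2) \<rho>] gram by (simp add: sum.distrib algebra_simps)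
  also have "\<dots> = tr \<rho>"
    unfolding tr_eq_sum_one[OF \<rho>] using c(1) by (intro sum.cong) (auto simp: orth_def)
  finally show ?thesis .
qed

lemma cone_op_sandwich_proj:
  assumes "is_proj d P"
  shows "cone_op d (sandwich P)"
proof (rule cone_op_sandwich)
  show "P \<in> carrier_mat d d" using assms by (rule is_proj_carrier)
  fix \<rho> assume \<rho>: "psd d \<rho>"
  have "0 \<le> Re (tr (sandwich (orth d P) \<rho>))"
    using is_proj_carrier[OF assms] \<rho> by (intro psd_tr_nonneg[of d] psd_sandwich[of _ d d]) auto
  then show "Re (tr (sandwich P \<rho>)) \<le> Re (tr \<rho>)"
    using arg_cong[OF tr_sandwich_proj_orth[OF assms psd_carrier[OF \<rho>]], of Re] by simp
qed

lemma cone_op_sandwich_unitary: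
  assumes "reg_ok n qs" "is_unitary (2 ^ length qs) U"
  shows "cone_op (2^n) (sandwich (ext_op n qs U))"
proof (rule cone_op_sandwich)
  fix \<rho> assume "psd (2^n) \<rho>"
  moreover have "adj (ext_op n qs U) * ext_op n qs U = 1\<^sub>m (2^n)"
    using assms by (simp add: is_unitary_def ext_op_adj ext_op_mult ext_op_one)
  ultimately show "Re (tr (sandwich (ext_op n qs U) \<rho>)) \<le> Re (tr \<rho>)"
    by (simp add: tr_sandwich_isometry[OF ext_op_carrier] psd_carrier)
qed simp

lemma cone_op_id: "cone_op d id"
  by (simp add: cone_op_def)

lemma cone_op_const_zero: "cone_op d (\<lambda>\<rho>. 0\<^sub>m d d)"
  by (auto simp: cone_op_def tr_def[of "0\<^sub>m d d"] psd_tr_nonneg intro!: eq_matI)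

lemma cone_op_convex:
  assumes E: "cone_op d E" and F: "cone_op d F" and p: "0 \<le> p" "p \<le> 1"
  shows "cone_op d (\<lambda>\<rho>. complex_of_real p \<cdot>\<^sub>m E \<rho> + complex_of_real (1 - p) \<cdot>\<^sub>m F \<rho>)"
  unfolding cone_op_def
proof (intro conjI allI impI)
  fix \<rho> :: cmat assume \<rho>: "psd d \<rho>"
  note c = cone_op_carrier[OF E \<rho>] cone_op_carrier[OF F \<rho>]
  show "psd d (complex_of_real p \<cdot>\<^sub>m E \<rho> + complex_of_real (1 - p) \<cdot>\<^sub>m F \<rho>)"
    using cone_opD(1)[OF E \<rho>] cone_opD(1)[OF F \<rho>] p by (intro psd_add psd_smult) auto
  have "Re (tr (complex_of_real p \<cdot>\<^sub>m E \<rho> + complex_of_real (1 - p) \<cdot>\<^sub>m F \<rho>)) =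
      p * Re (tr (E \<rho>)) + (1 - p) * Re (tr (F \<rho>))"
    using c tr_add[of "complex_of_real p \<cdot>\<^sub>m E \<rho>" d "complex_of_real (1 - p) \<cdot>\<^sub>m F \<rho>"]
    by (simp add: tr_smult del: of_real_diff)
  also have "\<dots> \<le> p * Re (tr \<rho>) + (1 - p) * Re (tr \<rho>)"
    using cone_opD(2)[OF E \<rho>] cone_opD(2)[OF F \<rho>] p by (intro add_mono mult_left_mono) auto
  finally show "Re (tr (complex_of_real p \<cdot>\<^sub>m E \<rho> + complex_of_real (1 - p) \<cdot>\<^sub>m F \<rho>)) \<le> Re (tr \<rho>)"
    by (simp add: algebra_simps)
  {
    fix \<sigma> assume \<sigma>: "psd d \<sigma>"
    show "complex_of_real p \<cdot>\<^sub>m E (\<rho> + \<sigma>) + complex_of_real (1 - p) \<cdot>\<^sub>m F (\<rho> + \<sigma>) =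
        complex_of_real p \<cdot>\<^sub>m E \<rho> + complex_of_real (1 - p) \<cdot>\<^sub>m F \<rho> +
        (complex_of_real p \<cdot>\<^sub>m E \<sigma> + complex_of_real (1 - p) \<cdot>\<^sub>m F \<sigma>)"
      unfolding cone_opD(3)[OF E \<rho> \<sigma>] cone_opD(3)[OF F \<rho> \<sigma>]
      using c cone_op_carrier[OF E \<sigma>] cone_op_carrier[OF F \<sigma>]
      by (intro eq_matI) (auto simp: algebra_simps)
  next
    fix r :: real assume r: "0 \<le> r"
    show "complex_of_real p \<cdot>\<^sub>m E (complex_of_real r \<cdot>\<^sub>m \<rho>) + complex_of_real (1 - p) \<cdot>\<^sub>m F (complex_of_real r \<cdot>\<^sub>m \<rho>) =
        complex_of_real r \<cdot>\<^sub>m (complex_of_real p \<cdot>\<^sub>m E \<rho> + complex_of_real (1 - p) \<cdot>\<^sub>m F \<rho>)"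
      unfolding cone_opD(4)[OF E \<rho> r] cone_opD(4)[OF F \<rho> r] using c
      by (intro eq_matI) (auto simp: algebra_simps)
  }
qed

lemma cone_op_branch:
  assumes E: "cone_op d E" and F: "cone_op d F" and P: "is_proj d P"
  shows "cone_op d (\<lambda>\<rho>. E (sandwich P \<rho>) + F (sandwich (orth d P) \<rho>))"
  unfolding cone_op_def
proof (intro conjI allI impI)
  note E' = cone_op_comp[OF cone_op_sandwich_proj[OF P] E]
  note F' = cone_op_comp[OF cone_op_sandwich_proj[OF orth_is_proj[OF P]] F]
  fix \<rho> :: cmat assume \<rho>: "psd d \<rho>"
  note c = cone_op_carrier[OF E' \<rho>] cone_op_carrier[OF F' \<rho>]
  show "psd d (E (sandwich P \<rho>) + F (sandwich (orth d P) \<rho>))"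
    using cone_opD(1)[OF E' \<rho>] cone_opD(1)[OF F' \<rho>] by (rule psd_add)
  have "Re (tr (E (sandwich P \<rho>))) + Re (tr (F (sandwich (orth d P) \<rho>))) \<le>
      Re (tr (sandwich P \<rho>)) + Re (tr (sandwich (orth d P) \<rho>))"
    using cone_opD(2)[OF E psd_sandwich[OF is_proj_carrier[OF P] \<rho>]]
      cone_opD(2)[OF F psd_sandwich[OF orth_carrier[OF is_proj_carrier[OF P]] \<rho>]]
    by (rule add_mono)
  then show "Re (tr (E (sandwich P \<rho>) + F (sandwich (orth d P) \<rho>))) \<le> Re (tr \<rho>)"
    using arg_cong[OF tr_sandwich_proj_orth[OF P psd_carrier[OF \<rho>]], of Re] tr_add[OF c] by simp
  {
    fix \<sigma> assume \<sigma>: "psd d \<sigma>"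
    show "E (sandwich P (\<rho> + \<sigma>)) + F (sandwich (orth d P) (\<rho> + \<sigma>)) =
        E (sandwich P \<rho>) + F (sandwich (orth d P) \<rho>) + (E (sandwich P \<sigma>) + F (sandwich (orth d P) \<sigma>))"
      unfolding cone_opD(3)[OF E' \<rho> \<sigma>] cone_opD(3)[OF F' \<rho> \<sigma>]
      using c cone_op_carrier[OF E' \<sigma>] cone_op_carrier[OF F' \<sigma>]
      by (intro eq_matI) (auto simp: algebra_simps)
  next
    fix r :: real assume r: "0 \<le> r"
    show "E (sandwich P (complex_of_real r \<cdot>\<^sub>m \<rho>)) + F (sandwich (orth d P) (complex_of_real r \<cdot>\<^sub>m \<rho>)) =
        complex_of_real r \<cdot>\<^sub>m (E (sandwich P \<rho>) + F (sandwich (orth d P) \<rho>))"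
      unfolding cone_opD(4)[OF E' \<rho> r] cone_opD(4)[OF F' \<rho> r] using c
      by (intro eq_matI) (auto simp: algebra_simps)
  }
qed

lemma msum_carrier: "(\<And>x. x \<in> set xs \<Longrightarrow> f x \<in> carrier_mat d d) \<Longrightarrow> msum d (map f xs) \<in> carrier_mat d d"
  by (induction xs) (auto simp: msum_def)

lemma msum_index:
  assumes "\<And>x. x \<in> set xs \<Longrightarrow> f x \<in> carrier_mat d d" "i < d" "j < d"
  shows "msum d (map f xs) $$ (i,j) = (\<Sum>x\<leftarrow>xs. f x $$ (i,j))"
  using assms(1)
proof (induction xs)
  case (Cons x xs)
  have "msum d (map f xs) \<in> carrier_mat d d" using Cons.prems by (intro msum_carrier) auto
  then have "(f x + msum d (map f xs)) $$ (i,j) = f x $$ (i,j) + msum d (map f xs) $$ (i,j)"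
    using assms(2,3) by simp
  then show ?case using Cons by (simp add: msum_def)
qed (use assms in \<open>simp add: msum_def\<close>)

lemma psd_msum: "(\<And>x. x \<in> set xs \<Longrightarrow> psd d (f x)) \<Longrightarrow> psd d (msum d (map f xs))"
  by (induction xs) (auto simp: msum_def intro: psd_add)

lemma cone_op_init:
  assumes qs: "reg_ok n qs"
  shows "cone_op (2^n) (\<lambda>\<rho>. msum (2^n)
    (map (\<lambda>i. sandwich (ext_op n qs (ket0bra (length qs) i)) \<rho>) [0..<2 ^ length qs]))"
  unfolding cone_op_def
proof (intro conjI allI impI)
  let ?d = "2^n :: nat" and ?k = "2 ^ length qs :: nat"
  let ?M = "\<lambda>i. ext_op n qs (ket0bra (length qs) i)"
  let ?I = "\<lambda>\<rho>. msum ?d (map (\<lambda>i. sandwich (?M i) \<rho>) [0..<?k])"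
  have car: "?I \<rho> \<in> carrier_mat ?d ?d" if "\<rho> \<in> carrier_mat ?d ?d" for \<rho>
    using that by (intro msum_carrier sandwich_carrier[of _ _ ?d]) auto
  have ind: "?I \<rho> $$ (a,b) = (\<Sum>i<?k. sandwich (?M i) \<rho> $$ (a,b))"
    if "\<rho> \<in> carrier_mat ?d ?d" "a < ?d" "b < ?d" for \<rho> a b
    using msum_index[of "[0..<?k]" "\<lambda>i. sandwich (?M i) \<rho>" ?d a b] that
      sandwich_carrier[OF ext_op_carrier that(1)]
    by (simp add: interv_sum_list_conv_sum_set_nat lessThan_atLeast0)
  fix \<rho> :: cmat assume \<rho>: "psd ?d \<rho>"
  note c = psd_carrier[OF \<rho>]
  show "psd ?d (?I \<rho>)" using \<rho> by (intro psd_msum psd_sandwich[of _ _ ?d]) auto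
  \<comment> \<open>The completeness relation of the Kraus operators: \<open>adj K * K\<close> for
    \<open>K = |0><i|\<close> is \<open>|i><i|\<close>, and these sum to the identity.\<close>
  have "(\<Sum>i<?k. (adj (?M i) * ?M i) $$ (l,m)) = 1\<^sub>m ?d $$ (l,m)" if lm: "l < ?d" "m < ?d" for l m
  proof -
    have "(adj (?M i) * ?M i) $$ (l,m) = (if i = loc qs l then if l = m then 1 else 0 else 0)" if "i < ?k" for i
    proof -
      let ?K = "ket0bra (length qs) i"
      have K: "?K \<in> carrier_mat ?k ?k" by (simp add: ket0bra_def)
      have "(adj ?K * ?K) $$ (a,b) = (if a = i \<and> b = i then 1 else 0)" if "a < ?k" "b < ?k" for a b
      proof -
        have "(adj ?K * ?K) $$ (a,b) = (\<Sum>c<?k. if c = 0 then if a = i \<and> b = i then 1 else 0 else 0)"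
          unfolding mult_index[OF adj_carrier[OF K] K that]
          by (intro sum.cong) (use that in \<open>auto simp: ket0bra_def\<close>)
        then show ?thesis by simp
      qed
      then show ?thesis
        using lm agree_off_loc_eq[OF qs lm]
        by (auto simp: ext_op_adj[OF K] ext_op_mult[OF qs adj_carrier[OF K] K] ext_op_index)
    qed
    then have "(\<Sum>i<?k. (adj (?M i) * ?M i) $$ (l,m)) =
        (\<Sum>i<?k. if i = loc qs l then if l = m then 1 else 0 else 0)"
      by (intro sum.cong) auto
    then show ?thesis using lm by simp
  qed
  note resolution = this
  have "tr (?I \<rho>) = (\<Sum>a<?d. \<Sum>i<?k. sandwich (?M i) \<rho> $$ (a,a))"
    using car[OF c] ind[OF c] by (auto simp: tr_def intro!: sum.cong)
  also have "\<dots> = (\<Sum>i<?k. tr (sandwich (?M i) \<rho>))"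
    by (subst sum.swap) (simp add: tr_def)
  also have "\<dots> = (\<Sum>i<?k. \<Sum>k<?d. \<Sum>l<?d. (adj (?M i) * ?M i) $$ (l,k) * \<rho> $$ (k,l))"
    by (simp add: tr_sandwich[OF ext_op_carrier c])
  also have "\<dots> = (\<Sum>k<?d. \<Sum>i<?k. \<Sum>l<?d. (adj (?M i) * ?M i) $$ (l,k) * \<rho> $$ (k,l))"
    by (rule sum.swap)
  also have "\<dots> = (\<Sum>k<?d. \<Sum>l<?d. \<Sum>i<?k. (adj (?M i) * ?M i) $$ (l,k) * \<rho> $$ (k,l))"
    by (rule sum.cong[OF refl sum.swap])
  also have "\<dots> = (\<Sum>k<?d. \<Sum>l<?d. 1\<^sub>m ?d $$ (l,k) * \<rho> $$ (k,l))"
    unfolding sum_distrib_right[symmetric] by (intro sum.cong refl) (simp only: resolution lessThan_iff)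
  also have "\<dots> = tr \<rho>" by (rule tr_eq_sum_one[OF c, symmetric])
  finally show "Re (tr (?I \<rho>)) \<le> Re (tr \<rho>)" by simp
  {
    fix \<sigma> assume "psd ?d \<sigma>"
    note c' = psd_carrier[OF this]
    show "?I (\<rho> + \<sigma>) = ?I \<rho> + ?I \<sigma>"
    proof (rule eq_matI)
      fix i j assume "i < dim_row (?I \<rho> + ?I \<sigma>)" "j < dim_col (?I \<rho> + ?I \<sigma>)"
      then have ij: "i < ?d" "j < ?d" using car[OF c'] by auto
      have s: "sandwich (?M x) \<sigma> \<in> carrier_mat ?d ?d" for x
        by (rule sandwich_carrier[OF ext_op_carrier c'])
      show "?I (\<rho> + \<sigma>) $$ (i,j) = (?I \<rho> + ?I \<sigma>) $$ (i,j)"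
      proof -
        have "?I (\<rho> + \<sigma>) $$ (i,j) = (\<Sum>x<?k. sandwich (?M x) \<rho> $$ (i,j) + sandwich (?M x) \<sigma> $$ (i,j))"
          unfolding ind[OF add_carrier_mat[OF c'] ij] unfolding sandwich_add[OF ext_op_carrier c c']
          by (intro sum.cong refl index_add_mat) (use ij s in auto)
        also have "\<dots> = ?I \<rho> $$ (i,j) + ?I \<sigma> $$ (i,j)"
          unfolding ind[OF c ij] ind[OF c' ij] by (rule sum.distrib)
        also have "\<dots> = (?I \<rho> + ?I \<sigma>) $$ (i,j)"
          using car[OF c'] ij by simp
        finally show ?thesis .
      qed
    qed (use car[OF c'] car[OF add_carrier_mat[OF c']] in auto)
  next
    fix r :: real
    show "?I (complex_of_real r \<cdot>\<^sub>m \<rho>) = complex_of_real r \<cdot>\<^sub>m ?I \<rho>"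
    proof (rule eq_matI)
      fix i j assume "i < dim_row (complex_of_real r \<cdot>\<^sub>m ?I \<rho>)" "j < dim_col (complex_of_real r \<cdot>\<^sub>m ?I \<rho>)"
      then have ij: "i < ?d" "j < ?d" using car[OF c] by auto
      show "?I (complex_of_real r \<cdot>\<^sub>m \<rho>) $$ (i,j) = (complex_of_real r \<cdot>\<^sub>m ?I \<rho>) $$ (i,j)"
      proof -
        have "?I (complex_of_real r \<cdot>\<^sub>m \<rho>) $$ (i,j) = (\<Sum>x<?k. complex_of_real r * sandwich (?M x) \<rho> $$ (i,j))"
          unfolding ind[OF smult_carrier_mat[OF c] ij] unfolding sandwich_smult[OF ext_op_carrier c]
          by (intro sum.cong refl index_smult_mat) (use ij in auto)
        also have "\<dots> = complex_of_real r * ?I \<rho> $$ (i,j)"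
          unfolding ind[OF c ij] by (rule sum_distrib_left[symmetric])
        also have "\<dots> = (complex_of_real r \<cdot>\<^sub>m ?I \<rho>) $$ (i,j)"
          using car[OF c] ij by simp
        finally show ?thesis .
      qed
    qed (use car[OF c] car[OF smult_carrier_mat[OF c]] in auto)
  }
qed

section \<open>Loops as convergent series\<close>

lemma cone_op_loop_iter:
  assumes E: "\<forall>k. cone_op d (E k)" and P: "is_proj d P"
  shows "cone_op d (\<lambda>\<rho>. loop_iter (sandwich P) E \<rho> k)"
proof (induction k)
  case 0
  then show ?case using cone_op_id by (simp add: id_def)
next
  case (Suc k)
  then show ?case
    using cone_op_comp[OF cone_op_comp[OF Suc cone_op_sandwich_proj[OF P]] E[rule_format, of "Suc k"]] by simp
qed

lemma minfsum_carrier [simp]: "minfsum d f \<in> carrier_mat d d"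
  by (simp add: minfsum_def)

text \<open>Entries of a psd matrix are bounded by its trace, so each entry series converges by
  comparison with the series of traces.\<close>

lemma minfsum_sums:
  assumes "summable (\<lambda>k. Re (tr (T k)))" "\<And>k. psd d (T k)" "i < d" "j < d"
  shows "(\<lambda>k. T k $$ (i,j)) sums (minfsum d T $$ (i,j))"
proof -
  have "summable (\<lambda>k. T k $$ (i,j))"
    using psd_index_le_tr[OF assms(2)] assms by (intro summable_comparison_test'[OF assms(1), of 0]) auto
  then show ?thesis using assms(3,4) by (simp add: minfsum_def summable_sums)
qed

lemma cone_op_while:
  assumes E: "\<forall>k. cone_op d (E k)" and P: "is_proj d P"
  shows "cone_op d (\<lambda>\<rho>. minfsum d (\<lambda>k. sandwich (orth d P) (loop_iter (sandwich P) E \<rho> k)))"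
  unfolding cone_op_def
proof (intro conjI allI impI)
  define r where "r \<rho> k = loop_iter (sandwich P) E \<rho> k" for \<rho> k
  define T where "T \<rho> k = sandwich (orth d P) (r \<rho> k)" for \<rho> k
  have r: "cone_op d (\<lambda>\<rho>. r \<rho> k)" for k
    unfolding r_def by (rule cone_op_loop_iter[OF E P])
  have T: "cone_op d (\<lambda>\<rho>. T \<rho> k)" for k
    unfolding T_def by (rule cone_op_comp[OF r cone_op_sandwich_proj[OF orth_is_proj[OF P]]])
  have c: "P \<in> carrier_mat d d" using P by (rule is_proj_carrier)
  \<comment> \<open>Trace already released by the loop plus trace still inside it never exceeds the
    initial trace. Dropping the second term bounds the partial sums and yields summability.\<close>
  have partial: "(\<Sum>k<N. Re (tr (T \<rho> k))) + Re (tr (r \<rho> N)) \<le> Re (tr \<rho>)" if \<rho>: "psd d \<rho>" for \<rho> N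
  proof (induction N)
    case 0
    then show ?case by (simp add: r_def)
  next
    case (Suc N)
    have rN: "psd d (r \<rho> N)" using cone_opD(1)[OF r \<rho>] .
    have "Re (tr (r \<rho> (Suc N))) \<le> Re (tr (sandwich P (r \<rho> N)))"
      using cone_opD(2)[OF E[rule_format] psd_sandwich[OF c rN]] by (simp add: r_def)
    then show ?case
      using Suc arg_cong[OF tr_sandwich_proj_orth[OF P psd_carrier[OF rN]], of Re] by (simp add: T_def)
  qed
  have nonneg: "0 \<le> Re (tr (T \<rho> k))" if "psd d \<rho>" for \<rho> k
    using psd_tr_nonneg[OF cone_opD(1)[OF T that]] .
  have bound: "(\<Sum>k<N. Re (tr (T \<rho> k))) \<le> Re (tr \<rho>)" if "psd d \<rho>" for \<rho> N
    using partial[OF that, of N] psd_tr_nonneg[OF cone_opD(1)[OF r that], of N] by linarith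
  have summable: "summable (\<lambda>k. Re (tr (T \<rho> k)))" if "psd d \<rho>" for \<rho>
    using nonneg[OF that] bound[OF that] by (rule summableI_nonneg_bounded)
  have sums: "(\<lambda>k. T \<rho> k $$ (i,j)) sums (minfsum d (T \<rho>) $$ (i,j))" if "psd d \<rho>" "i < d" "j < d" for \<rho> i j
    using minfsum_sums[OF summable[OF that(1)] cone_opD(1)[OF T that(1)] that(2,3)] .
  have T_eq: "(\<lambda>k. sandwich (orth d P) (loop_iter (sandwich P) E \<rho> k)) = T \<rho>" for \<rho>
    by (simp add: T_def r_def fun_eq_iff)
  fix \<rho> :: cmat assume \<rho>: "psd d \<rho>"
  note cT = cone_op_carrier[OF T \<rho>]
  show "psd d (minfsum d (\<lambda>k. sandwich (orth d P) (loop_iter (sandwich P) E \<rho> k)))"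
    unfolding T_eq psd_iff_bform
  proof (intro conjI allI minfsum_carrier)
    fix v
    \<comment> \<open>The form is a finite combination of entries, so it converges with them, and
      both sign conditions pass to the limit.\<close>
    have s: "(\<lambda>k. bform d (T \<rho> k) v v) sums bform d (minfsum d (T \<rho>)) v v"
      unfolding bform_def by (intro sums_sum sums_mult sums_mult2 sums[OF \<rho>]) auto
    have "(\<lambda>k. Im (bform d (T \<rho> k) v v)) sums Im (bform d (minfsum d (T \<rho>)) v v)"
      using sums_Im[OF s] .
    then show "Im (bform d (minfsum d (T \<rho>)) v v) = 0"
      using psdD(1)[OF cone_opD(1)[OF T \<rho>]] by (simp add: sums_iff)
    show "0 \<le> Re (bform d (minfsum d (T \<rho>)) v v)"
      using psdD(2)[OF cone_opD(1)[OF T \<rho>]] by (intro sums_le[OF _ sums_zero sums_Re[OF s]]) auto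
  qed
  have "(\<lambda>k. Re (tr (T \<rho> k))) sums Re (tr (minfsum d (T \<rho>)))"
    unfolding Re_tr[OF cT] Re_tr[OF minfsum_carrier] by (intro sums_sum sums_Re sums[OF \<rho>]) auto
  then have "Re (tr (minfsum d (T \<rho>))) \<le> Re (tr \<rho>)"
    using suminf_le_const[OF summable[OF \<rho>] bound[OF \<rho>]] by (simp add: sums_iff)
  then show "Re (tr (minfsum d (\<lambda>k. sandwich (orth d P) (loop_iter (sandwich P) E \<rho> k)))) \<le> Re (tr \<rho>)"
    unfolding T_eq .
  {
    fix \<sigma> assume \<sigma>: "psd d \<sigma>"
    have "minfsum d (T (\<rho> + \<sigma>)) $$ (i,j) = minfsum d (T \<rho>) $$ (i,j) + minfsum d (T \<sigma>) $$ (i,j)"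
      if ij: "i < d" "j < d" for i j
    proof (rule sums_unique2)
      show "(\<lambda>k. T (\<rho> + \<sigma>) k $$ (i,j)) sums (minfsum d (T (\<rho> + \<sigma>)) $$ (i,j))"
        by (rule sums[OF psd_add[OF \<rho> \<sigma>] ij])
      have "T (\<rho> + \<sigma>) k $$ (i,j) = T \<rho> k $$ (i,j) + T \<sigma> k $$ (i,j)" for k
        using ij cone_op_carrier[OF T \<sigma>, of k] by (simp add: cone_opD(3)[OF T \<rho> \<sigma>])
      then show "(\<lambda>k. T (\<rho> + \<sigma>) k $$ (i,j)) sums (minfsum d (T \<rho>) $$ (i,j) + minfsum d (T \<sigma>) $$ (i,j))"
        using sums_add[OF sums[OF \<rho> ij] sums[OF \<sigma> ij]] by simp
    qed
    then show "minfsum d (\<lambda>k. sandwich (orth d P) (loop_iter (sandwich P) E (\<rho> + \<sigma>) k)) =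
        minfsum d (\<lambda>k. sandwich (orth d P) (loop_iter (sandwich P) E \<rho> k)) +
        minfsum d (\<lambda>k. sandwich (orth d P) (loop_iter (sandwich P) E \<sigma> k))"
      unfolding T_eq by (intro eq_matI) (auto simp: minfsum_def)
  next
    fix a :: real assume a: "0 \<le> a"
    have "minfsum d (T (complex_of_real a \<cdot>\<^sub>m \<rho>)) $$ (i,j) = complex_of_real a * minfsum d (T \<rho>) $$ (i,j)"
      if ij: "i < d" "j < d" for i j
    proof (rule sums_unique2)
      show "(\<lambda>k. T (complex_of_real a \<cdot>\<^sub>m \<rho>) k $$ (i,j)) sums (minfsum d (T (complex_of_real a \<cdot>\<^sub>m \<rho>)) $$ (i,j))"
        by (rule sums[OF psd_smult[OF \<rho> a] ij])
      have "T (complex_of_real a \<cdot>\<^sub>m \<rho>) k $$ (i,j) = complex_of_real a * T \<rho> k $$ (i,j)" for k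
        using ij cT[of k] by (simp add: cone_opD(4)[OF T \<rho> a])
      then show "(\<lambda>k. T (complex_of_real a \<cdot>\<^sub>m \<rho>) k $$ (i,j)) sums (complex_of_real a * minfsum d (T \<rho>) $$ (i,j))"
        using sums_mult[OF sums[OF \<rho> ij]] by simp
    qed
    then show "minfsum d (\<lambda>k. sandwich (orth d P) (loop_iter (sandwich P) E (complex_of_real a \<cdot>\<^sub>m \<rho>) k)) =
        complex_of_real a \<cdot>\<^sub>m minfsum d (\<lambda>k. sandwich (orth d P) (loop_iter (sandwich P) E \<rho> k))"
      unfolding T_eq by (intro eq_matI) (auto simp: minfsum_def)
  }
qed

section \<open>Super-operators extended from a register\<close>

lemma psd_reindex:
  assumes A: "psd d A" and f: "\<And>x. x < e \<Longrightarrow> f x < d"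
  shows "psd e (Matrix.mat e e (\<lambda>(x,y). A $$ (f x, f y)))"
proof -
  \<comment> \<open>The 0/1 matrix whose row x selects coordinate \<open>f x\<close>; reindexing is
    conjugation by it, so positivity is inherited.\<close>
  define V :: cmat where "V = Matrix.mat e d (\<lambda>(x,l). if l = f x then 1 else 0)"
  have V: "V \<in> carrier_mat e d" by (simp add: V_def)
  have "sandwich V A = Matrix.mat e e (\<lambda>(x,y). A $$ (f x, f y))"
  proof (rule eq_matI)
    fix x y assume "x < dim_row (Matrix.mat e e (\<lambda>(x,y). A $$ (f x, f y)))"
      "y < dim_col (Matrix.mat e e (\<lambda>(x,y). A $$ (f x, f y)))"
    then have xy: "x < e" "y < e" by auto
    have "sandwich V A $$ (x,y) = (\<Sum>k<d. \<Sum>l<d. if k = f x then if l = f y then A $$ (k,l) else 0 else 0)"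
      unfolding sandwich_index[OF V psd_carrier[OF A] xy] by (intro sum.cong) (use xy in \<open>auto simp: V_def\<close>)
    also have "\<dots> = (\<Sum>k<d. if k = f x then A $$ (k, f y) else 0)"
      by (intro sum.cong) (use f[OF xy(2)] in auto)
    finally show "sandwich V A $$ (x,y) = Matrix.mat e e (\<lambda>(x,y). A $$ (f x, f y)) $$ (x,y)"
      using f[OF xy(1)] xy by simp
  qed (use V in auto)
  then show ?thesis using psd_sandwich[OF V A] by simp
qed

text \<open>The operator on the register obtained by fixing the row and column states of the
  remaining qubits as in i and j. \<open>ext_so\<close> applies E to each of these blocks.\<close>

definition block :: "nat \<Rightarrow> nat list \<Rightarrow> cmat \<Rightarrow> nat \<Rightarrow> nat \<Rightarrow> cmat" where
  "block n qs \<rho> i j = Matrix.mat (2 ^ length qs) (2 ^ length qs) (\<lambda>(a,b). \<rho> $$ (place n qs i a, place n qs j b))"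

lemma block_carrier [simp]: "block n qs \<rho> i j \<in> carrier_mat (2 ^ length qs) (2 ^ length qs)"
  by (simp add: block_def)

lemma ext_so_carrier [simp]: "ext_so n qs E \<rho> \<in> carrier_mat (2^n) (2^n)"
  by (simp add: ext_so_def)

lemma ext_so_index:
  assumes "i < 2^n" "j < 2^n"
  shows "ext_so n qs E \<rho> $$ (i,j) = E (block n qs \<rho> i j) $$ (loc qs i, loc qs j)"
  using assms by (simp add: ext_so_def block_def)

text \<open>Positivity of \<open>E \<otimes> id\<close> is only postulated for registers of leading qubits; a permutation of the
  qubits, i.e. of the basis indices, transfers it to an arbitrary register.\<close>

lemma psd_ext_so:
  assumes qs: "reg_ok n qs" and E: "cp_tni (length qs) E" and \<rho>: "psd (2^n) \<rho>"
  shows "psd (2^n) (ext_so n qs E \<rho>)"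
proof -
  \<comment> \<open>All qubits, those of the register first: the reordering under which the register
    becomes the leading one.\<close>
  define ps where "ps = qs @ filter (\<lambda>q. q \<notin> set qs) [0..<n]"
  let ?k = "length qs"
  have "distinct ps" "set ps = {..<n}" using qs by (auto simp: ps_def reg_ok_def)
  then have ps: "reg_ok n ps" "length ps = n" using distinct_card[of ps] by (auto simp: reg_ok_def)
  then have "?k \<le> n" by (simp add: ps_def)
  \<comment> \<open>Translates an index of the reordered basis back to the original one, inversely
    to \<open>loc ps\<close>. The base index 0 leaves no trace since every qubit is
    overwritten.\<close>
  define \<tau> where "\<tau> = place n ps 0"
  define \<rho>' where "\<rho>' = Matrix.mat (2^n) (2^n) (\<lambda>(x,y). \<rho> $$ (\<tau> x, \<tau> y))"
  have \<rho>': "psd (2^n) \<rho>'" unfolding \<rho>'_def by (rule psd_reindex[OF \<rho>]) (simp add: \<tau>_def)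
  have ps_nth: "ps ! t = qs ! t" if "t < ?k" for t using that by (simp add: ps_def nth_append)
  have ps_notin: "ps ! t \<notin> set qs" if "?k \<le> t" "t < n" for t
  proof -
    have "ps ! t \<in> set (filter (\<lambda>q. q \<notin> set qs) [0..<n])"
      using that ps(2) nth_mem[of "t - ?k" "filter (\<lambda>q. q \<notin> set qs) [0..<n]"]
      by (simp add: ps_def nth_append del: set_filter)
    then show ?thesis by simp
  qed
  have loc_eq: "loc [0..<?k] (loc ps i) = loc qs i" for i
  proof -
    have "loc [0..<?k] (loc ps i) < 2 ^ ?k" using loc_less[of "[0..<?k]"] by simp
    then show ?thesis
      by (rule bitv_eqI) (use \<open>?k \<le> n\<close> ps(2) in \<open>auto simp: bitv_loc ps_nth\<close>)
  qed
  have place_eq: "\<tau> (place n [0..<?k] (loc ps i) a) = place n qs i a" for i a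
  proof (rule bitv_eqI)
    fix q assume "q < n"
    then obtain t where t: "t < n" "q = ps ! t"
      using \<open>set ps = {..<n}\<close> ps(2) by (metis in_set_conv_nth lessThan_iff)
    have ok: "reg_ok n [0..<?k]" using \<open>?k \<le> n\<close> by (auto simp: reg_ok_def)
    have "bitv (\<tau> (place n [0..<?k] (loc ps i) a)) q = bitv (place n [0..<?k] (loc ps i) a) t"
      using t ps by (simp add: \<tau>_def bitv_place_nth)
    also have "\<dots> = bitv (place n qs i a) q"
    proof (cases "t < ?k")
      case True
      then show ?thesis
        using bitv_place_nth[OF ok, of t "loc ps i" a] bitv_place_nth[OF qs True] t by (simp add: ps_nth)
    next
      case False
      then show ?thesis using t ps \<open>q < n\<close> ps_notin[of t] by (simp add: bitv_place_notin bitv_loc)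
    qed
    finally show "bitv (\<tau> (place n [0..<?k] (loc ps i) a)) q = bitv (place n qs i a) q" .
  qed (simp_all add: \<tau>_def)
  have block_eq: "block n [0..<?k] \<rho>' (loc ps i) (loc ps j) = block n qs \<rho> i j" for i j
    by (rule eq_matI) (simp_all add: block_def \<rho>'_def place_eq)
  have loc_less': "loc ps i < 2^n" for i using loc_less[of ps i] ps(2) by simp
  have "ext_so n qs E \<rho> = Matrix.mat (2^n) (2^n) (\<lambda>(i,j). ext_so n [0..<?k] E \<rho>' $$ (loc ps i, loc ps j))"
    using carrier_matD[OF ext_so_carrier]
    by (intro eq_matI) (simp_all add: ext_so_index loc_less' block_eq loc_eq)
  moreover have "psd (2^n) (ext_so n [0..<?k] E \<rho>')"
  proof -
    have "psd (2 ^ (?k + (n - ?k))) (ext_so (?k + (n - ?k)) [0..<?k] E \<rho>')"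
      using E \<rho>' \<open>?k \<le> n\<close> unfolding cp_tni_def by (metis le_add_diff_inverse)
    then show ?thesis using \<open>?k \<le> n\<close> by simp
  qed
  ultimately show ?thesis using psd_reindex[OF _ loc_less'] by simp
qed

lemma tr_ext_so_le:
  assumes qs: "reg_ok n qs" and E: "cp_tni (length qs) E" and \<rho>: "psd (2^n) \<rho>"
  shows "Re (tr (ext_so n qs E \<rho>)) \<le> Re (tr \<rho>)"
proof -
  let ?k = "2 ^ length qs :: nat"
  let ?h = "\<lambda>i. Re (E (block n qs \<rho> i i) $$ (loc qs i, loc qs i))"
  \<comment> \<open>Summing over all indices instead of choosing one per class counts every class
    \<open>2 ^ length qs\<close> times; the factor compensates and cancels at the end.\<close>
  have "2 ^ length qs * Re (tr (ext_so n qs E \<rho>)) = (2 ^ length qs :: real) * (\<Sum>i<2^n. ?h i)"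
    by (simp add: Re_tr[OF ext_so_carrier] ext_so_index)
  also have "\<dots> = (\<Sum>i<2^n. \<Sum>a<?k. ?h (place n qs i a))"
    by (rule sum_sum_place[OF qs, symmetric])
  also have "\<dots> \<le> (\<Sum>i<2^n. \<Sum>a<?k. Re (\<rho> $$ (place n qs i a, place n qs i a)))"
  proof (rule sum_mono)
    fix i :: nat
    \<comment> \<open>All members of a class share the same diagonal block, so the inner sum is the
      trace of E on that block, where the local trace bound applies.\<close>
    have b: "block n qs \<rho> (place n qs i a) (place n qs i a) = block n qs \<rho> i i" for a
      by (simp add: block_def place_place[OF qs])
    have psd: "psd ?k (block n qs \<rho> i i)"
      unfolding block_def by (rule psd_reindex[OF \<rho>]) simp
    have "E (block n qs \<rho> i i) \<in> carrier_mat ?k ?k" using E unfolding cp_tni_def by simp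
    then have "(\<Sum>a<?k. ?h (place n qs i a)) = Re (tr (E (block n qs \<rho> i i)))"
      by (simp add: Re_tr b loc_place[OF qs])
    also have "\<dots> \<le> Re (tr (block n qs \<rho> i i))" using E psd unfolding cp_tni_def by blast
    also have "\<dots> = (\<Sum>a<?k. Re (\<rho> $$ (place n qs i a, place n qs i a)))"
      unfolding Re_tr[OF block_carrier] by (simp add: block_def)
    finally show "(\<Sum>a<?k. ?h (place n qs i a)) \<le> (\<Sum>a<?k. Re (\<rho> $$ (place n qs i a, place n qs i a)))" .
  qed
  also have "\<dots> = 2 ^ length qs * (\<Sum>i<2^n. Re (\<rho> $$ (i,i)))"
    by (rule sum_sum_place[OF qs])
  also have "\<dots> = 2 ^ length qs * Re (tr \<rho>)" by (simp add: Re_tr[OF psd_carrier[OF \<rho>]])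
  finally show ?thesis by simp
qed

lemma cone_op_ext_so:
  assumes qs: "reg_ok n qs" and E: "cp_tni (length qs) E"
  shows "cone_op (2^n) (ext_so n qs E)"
  unfolding cone_op_def
proof (intro conjI allI impI)
  let ?k = "2 ^ length qs :: nat"
  have car: "E A \<in> carrier_mat ?k ?k" if "A \<in> carrier_mat ?k ?k" for A
    using E that unfolding cp_tni_def by blast
  have lin: "E (c \<cdot>\<^sub>m A + B) = c \<cdot>\<^sub>m E A + E B"
    if "A \<in> carrier_mat ?k ?k" "B \<in> carrier_mat ?k ?k" for c A B
    using E that unfolding cp_tni_def by blast
  fix \<rho> :: cmat assume \<rho>: "psd (2^n) \<rho>"
  show "psd (2^n) (ext_so n qs E \<rho>)" using psd_ext_so[OF qs E \<rho>] .
  show "Re (tr (ext_so n qs E \<rho>)) \<le> Re (tr \<rho>)" using tr_ext_so_le[OF qs E \<rho>] .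
  {
    fix \<sigma> assume \<sigma>: "psd (2^n) \<sigma>"
    have "block n qs (\<rho> + \<sigma>) i j = 1 \<cdot>\<^sub>m block n qs \<rho> i j + block n qs \<sigma> i j" for i j
      using psd_carrier[OF \<sigma>] by (intro eq_matI) (auto simp: block_def)
    then have "E (block n qs (\<rho> + \<sigma>) i j) $$ (a,b) = E (block n qs \<rho> i j) $$ (a,b) + E (block n qs \<sigma> i j) $$ (a,b)"
      if "a < ?k" "b < ?k" for i j a b
      using that car[OF block_carrier] carrier_matD[OF car[OF block_carrier]] by (simp add: lin)
    then show "ext_so n qs E (\<rho> + \<sigma>) = ext_so n qs E \<rho> + ext_so n qs E \<sigma>"
      using carrier_matD[OF ext_so_carrier] by (intro eq_matI) (simp_all add: ext_so_index)
  next
    fix r :: real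
    let ?c = "complex_of_real r"
    \<comment> \<open>Splitting off one copy gives homogeneity directly from the combined linearity
      law, without evaluating E at zero.\<close>
    have "block n qs (?c \<cdot>\<^sub>m \<rho>) i j = (?c - 1) \<cdot>\<^sub>m block n qs \<rho> i j + block n qs \<rho> i j" for i j
      using psd_carrier[OF \<rho>] by (intro eq_matI) (auto simp: block_def algebra_simps)
    then have "E (block n qs (?c \<cdot>\<^sub>m \<rho>) i j) $$ (a,b) = ?c * E (block n qs \<rho> i j) $$ (a,b)"
      if "a < ?k" "b < ?k" for i j a b
      using that carrier_matD[OF car[OF block_carrier]] by (simp add: lin algebra_simps)
    then show "ext_so n qs E (?c \<cdot>\<^sub>m \<rho>) = ?c \<cdot>\<^sub>m ext_so n qs E \<rho>"
      using carrier_matD[OF ext_so_carrier] by (intro eq_matI) (simp_all add: ext_so_index)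
  }
qed

text \<open>All later reasoning about triples uses S only through this fact, never through its
  syntax.\<close>

lemma den_cone_op: "wf_prog n S \<Longrightarrow> E \<in> den n S \<Longrightarrow> cone_op (2^n) E"
proof (induction S arbitrary: E)
  case Skip
  then have "E = id" by simp
  then show ?case by (simp only: cone_op_id)
next
  case Abort
  then show ?case by (simp add: cone_op_const_zero)
next
  case (Init qs)
  then show ?case using cone_op_init[of n qs] by simp
next
  case (Unit qs U)
  then show ?case using cone_op_sandwich_unitary[of n qs U] by simp
next
  case (Assert P qs)
  then show ?case using cone_op_sandwich_proj[OF ext_op_proj[of n qs P]] by simp
next
  case (Spec P Q qs)
  then show ?case using cone_op_ext_so[of n qs] by auto
next
  case (Choice S0 p S1)
  then show ?case using cone_op_convex[of "2^n" _ _ p] by auto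
next
  case (Seq S0 S1)
  then show ?case using cone_op_comp[of "2^n"] by (auto simp: comp_def)
next
  case (If P qs S1 S0)
  then have "is_proj (2 ^ length qs) P" "reg_ok n qs" by auto
  then show ?case
    using If cone_op_branch[OF _ _ ext_op_proj[of n qs P]] ext_op_orth[of n qs P] is_proj_carrier[of "2 ^ length qs" P] by auto
next
  case (While P qs S)
  then obtain Es where Es: "\<forall>k. Es k \<in> den n S"
    "E = (\<lambda>\<rho>. minfsum (2^n) (\<lambda>k. sandwich (ext_op n qs (orth (2 ^ length qs) P))
        (loop_iter (sandwich (ext_op n qs P)) Es \<rho> k)))" by auto
  have P: "is_proj (2 ^ length qs) P" "reg_ok n qs" using While.prems(1) by auto
  have "\<forall>k. cone_op (2^n) (Es k)" using While Es(1) by auto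
  from cone_op_while[OF this ext_op_proj[OF P(2,1)]] show ?case
    unfolding Es(2) ext_op_orth[OF P(2) is_proj_carrier[OF P(1)]] .
qed

section \<open>Assertions around a program\<close>

lemma wf_assertV: "is_proj (2^n) P \<Longrightarrow> wf_prog n (assertV n P)"
  by (auto simp: assertV_def reg_ok_def)

lemma den_assertV: "is_proj (2^n) P \<Longrightarrow> den n (assertV n P) = {sandwich P}"
  by (simp add: assertV_def ext_op_all is_proj_carrier)

lemma valid_iff_psd_wf:
  assumes "wf_prog n S" "is_proj (2^n) P" "is_proj (2^n) Q"
  shows "valid n P S Q \<longleftrightarrow>
    (\<forall>E\<in>den n S. \<forall>\<rho>. psd (2^n) \<rho> \<longrightarrow> models (2^n) \<rho> P \<longrightarrow> models (2^n) (E \<rho>) Q)"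
  using den_cone_op[OF assms(1)] by (intro valid_iff_psd assms(2,3)) blast

lemma valid_assert_both_iff:
  assumes S: "wf_prog n S" and P: "is_proj (2^n) P" and Q: "is_proj (2^n) Q"
    and R: "is_proj (2^n) R" and T: "is_proj (2^n) T"
  shows "valid n R (Seq (Seq (assertV n P) S) (assertV n Q)) T \<longleftrightarrow>
    (\<forall>E\<in>den n S. \<forall>\<rho>. psd (2^n) \<rho> \<longrightarrow> models (2^n) \<rho> R \<longrightarrow> models (2^n) (sandwich Q (E (sandwich P \<rho>))) T)"
proof -
  have "den n (Seq (Seq (assertV n P) S) (assertV n Q)) = (\<lambda>E \<rho>. sandwich Q (E (sandwich P \<rho>))) ` den n S"
    using P Q by (auto simp: den_assertV comp_def)
  then show ?thesis using assms by (subst valid_iff_psd_wf) (simp_all add: wf_assertV)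
qed

lemma valid_assert_before_iff:
  assumes S: "wf_prog n S" and P: "is_proj (2^n) P" and R: "is_proj (2^n) R" and T: "is_proj (2^n) T"
  shows "valid n R (Seq (assertV n P) S) T \<longleftrightarrow>
    (\<forall>E\<in>den n S. \<forall>\<rho>. psd (2^n) \<rho> \<longrightarrow> models (2^n) \<rho> R \<longrightarrow> models (2^n) (E (sandwich P \<rho>)) T)"
  using assms by (subst valid_iff_psd_wf) (auto simp: wf_assertV den_assertV)

lemma valid_assert_after_iff:
  assumes S: "wf_prog n S" and Q: "is_proj (2^n) Q" and R: "is_proj (2^n) R" and T: "is_proj (2^n) T"
  shows "valid n R (Seq S (assertV n Q)) T \<longleftrightarrow>
    (\<forall>E\<in>den n S. \<forall>\<rho>. psd (2^n) \<rho> \<longrightarrow> models (2^n) \<rho> R \<longrightarrow> models (2^n) (sandwich Q (E \<rho>)) T)"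
  using assms by (subst valid_iff_psd_wf) (auto simp: wf_assertV den_assertV)

lemma assert_after_iff_valid:
  assumes S: "wf_prog n S" and P: "is_proj (2^n) P" and Q: "is_proj (2^n) Q"
  shows "prog_equiv n (Seq (assertV n P) S) (Seq (Seq (assertV n P) S) (assertV n Q)) \<longleftrightarrow> valid n P S Q"
proof
  let ?d = "2^n :: nat"
  have psd_P: "psd ?d (sandwich P \<rho>)" if "psd ?d \<rho>" for \<rho>
    using is_proj_carrier[OF P] that by (rule psd_sandwich)
  {
    assume equiv: "prog_equiv n (Seq (assertV n P) S) (Seq (Seq (assertV n P) S) (assertV n Q))"
    have "models ?d (sandwich Q (E (sandwich P \<rho>))) Q" if "E \<in> den n S" "psd ?d \<rho>" for E \<rho>
      using models_sandwich[OF Q] cone_op_carrier[OF den_cone_op[OF S that(1)] psd_P[OF that(2)]] by blast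
    \<comment> \<open>The final assertion forces Q on every input, so the triple holds from the full
      space; transferred to the shorter program, it is restricted to inputs in P, which the leading
      assertion leaves unchanged.\<close>
    then have "valid n (1\<^sub>m ?d) (Seq (Seq (assertV n P) S) (assertV n Q)) Q"
      by (simp add: valid_assert_both_iff[OF S P Q is_proj_one Q])
    then have "valid n (1\<^sub>m ?d) (Seq (assertV n P) S) Q"
      using equiv Q is_proj_one unfolding prog_equiv_def refines_def by blast
    then have before: "models ?d (E (sandwich P \<rho>)) Q" if "E \<in> den n S" "psd ?d \<rho>" for E \<rho>
      using that psd_carrier[OF that(2)] by (simp add: valid_assert_before_iff[OF S P is_proj_one Q])
    have "models ?d (E \<rho>) Q" if "E \<in> den n S" "psd ?d \<rho>" "models ?d \<rho> P" for E \<rho>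
      using before[OF that(1,2)] sandwich_eq_self[OF P that(2,3)] by simp
    then show "valid n P S Q" by (simp add: valid_iff_psd_wf[OF S P Q])
  next
    assume valid: "valid n P S Q"
    \<comment> \<open>Outputs already lie in Q, so the final assertion acts as the identity and both
      programs agree on all psd inputs.\<close>
    have eq: "sandwich Q (E (sandwich P \<rho>)) = E (sandwich P \<rho>)" if "E \<in> den n S" "psd ?d \<rho>" for E \<rho>
    proof (rule sandwich_eq_self[OF Q])
      show "psd ?d (E (sandwich P \<rho>))"
        using cone_opD(1)[OF den_cone_op[OF S that(1)] psd_P[OF that(2)]] .
      show "models ?d (E (sandwich P \<rho>)) Q"
        using valid that psd_P[OF that(2)] models_sandwich[OF P psd_carrier[OF that(2)]]
        unfolding valid_iff_psd_wf[OF S P Q] by blast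
    qed
    have "valid n R (Seq (assertV n P) S) T \<longleftrightarrow> valid n R (Seq (Seq (assertV n P) S) (assertV n Q)) T"
      if "is_proj ?d R" "is_proj ?d T" for R T
      unfolding valid_assert_before_iff[OF S P that] valid_assert_both_iff[OF S P Q that]
      by (simp add: eq)
    then show "prog_equiv n (Seq (assertV n P) S) (Seq (Seq (assertV n P) S) (assertV n Q))"
      unfolding prog_equiv_def refines_def by blast
  }
qed

lemma assert_before_iff_valid:
  assumes S: "wf_prog n S" and P: "is_proj (2^n) P" and Q: "is_proj (2^n) Q"
  shows "prog_equiv n (Seq S (assertV n Q)) (Seq (Seq (assertV n P) S) (assertV n Q)) \<longleftrightarrow>
    valid n (orth (2^n) P) S (orth (2^n) Q)"
proof
  let ?d = "2^n :: nat"
  let ?P' = "orth ?d P" and ?Q' = "orth ?d Q"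
  have P': "is_proj ?d ?P'" and Q': "is_proj ?d ?Q'" using P Q by (auto intro: orth_is_proj)
  have orth_P: "orth ?d ?P' = P" and orth_Q: "orth ?d ?Q' = Q"
    using is_proj_carrier[OF P] is_proj_carrier[OF Q] by (auto intro: orth_orth)
  \<comment> \<open>Postcondition zero means that the asserted output vanishes; this translates a
    triple about the program with trailing assertion into one about S alone.\<close>
  have after_zero: "models ?d (sandwich Q (E \<rho>)) (0\<^sub>m ?d ?d) \<longleftrightarrow> models ?d (E \<rho>) ?Q'"
    if "E \<in> den n S" "psd ?d \<rho>" for E \<rho>
  proof -
    have psd: "psd ?d (E \<rho>)" using cone_opD(1)[OF den_cone_op[OF S that(1)] that(2)] .
    have c: "sandwich Q (E \<rho>) \<in> carrier_mat ?d ?d"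
      using is_proj_carrier[OF Q] psd_carrier[OF psd] by simp
    then have "models ?d (sandwich Q (E \<rho>)) (0\<^sub>m ?d ?d) \<longleftrightarrow> sandwich Q (E \<rho>) = 0\<^sub>m ?d ?d"
      using models_iff_mult[OF is_proj_zero c] by auto
    then show ?thesis using models_iff_sandwich_orth[OF Q' psd] orth_Q by simp
  qed
  {
    assume equiv: "prog_equiv n (Seq S (assertV n Q)) (Seq (Seq (assertV n P) S) (assertV n Q))"
    have "sandwich Q (E (sandwich P \<rho>)) = 0\<^sub>m ?d ?d"
      if "E \<in> den n S" "psd ?d \<rho>" "models ?d \<rho> ?P'" for E \<rho>
    proof -
      \<comment> \<open>The leading assertion annihilates inputs in the complement of P, so the
        longer program meets even the zero postcondition there.\<close>
      have "sandwich P \<rho> = 0\<^sub>m ?d ?d" using models_iff_sandwich_orth[OF P' that(2)] that(3) orth_P by simp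
      then show ?thesis
        using cone_op_zero[OF den_cone_op[OF S that(1)]] cone_op_zero[OF cone_op_sandwich_proj[OF Q]] by simp
    qed
    then have "valid n ?P' (Seq (Seq (assertV n P) S) (assertV n Q)) (0\<^sub>m ?d ?d)"
      by (simp add: valid_assert_both_iff[OF S P Q P' is_proj_zero])
    then have "valid n ?P' (Seq S (assertV n Q)) (0\<^sub>m ?d ?d)"
      using equiv P' is_proj_zero unfolding prog_equiv_def refines_def by blast
    then show "valid n ?P' S ?Q'"
      unfolding valid_assert_after_iff[OF S Q P' is_proj_zero] valid_iff_psd_wf[OF S P' Q']
      using after_zero by blast
  next
    assume valid: "valid n ?P' S ?Q'"
    \<comment> \<open>Only supports of the two outputs are compared, not the outputs themselves;
      refinement sees no more than that.\<close>
    have iff: "models ?d (sandwich Q (E (sandwich P \<rho>))) T \<longleftrightarrow> models ?d (sandwich Q (E \<rho>)) T"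
      if "E \<in> den n S" "psd ?d \<rho>" "is_proj ?d T" for E \<rho> T
    proof (rule cone_op_models_sandwich_iff[OF _ P that(3,2)])
      show "cone_op ?d (\<lambda>\<rho>. sandwich Q (E \<rho>))"
        by (rule cone_op_comp[OF den_cone_op[OF S that(1)] cone_op_sandwich_proj[OF Q]])
      have psd: "psd ?d (sandwich ?P' \<rho>)" using is_proj_carrier[OF P'] that(2) by (rule psd_sandwich)
      then have "models ?d (E (sandwich ?P' \<rho>)) ?Q'"
        using valid that(1) models_sandwich[OF P' psd_carrier[OF that(2)]]
        unfolding valid_iff_psd_wf[OF S P' Q'] by blast
      then show "sandwich Q (E (sandwich ?P' \<rho>)) = 0\<^sub>m ?d ?d"
        using models_iff_sandwich_orth[OF Q' cone_opD(1)[OF den_cone_op[OF S that(1)] psd]] orth_Q by simp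
    qed
    have "valid n R (Seq S (assertV n Q)) T \<longleftrightarrow> valid n R (Seq (Seq (assertV n P) S) (assertV n Q)) T"
      if "is_proj ?d R" "is_proj ?d T" for R T
      unfolding valid_assert_after_iff[OF S Q that] valid_assert_both_iff[OF S P Q that]
      using iff[OF _ _ that(2)] by blast
    then show "prog_equiv n (Seq S (assertV n Q)) (Seq (Seq (assertV n P) S) (assertV n Q))"
      unfolding prog_equiv_def refines_def by blast
  }
qed

theorem theorem4p6:
  fixes n :: nat and P Q :: "complex mat" and S :: prog
  assumes "wf_prog n S" and "is_proj (2^n) P" and "is_proj (2^n) Q"
  shows
   "((prog_equiv n (Seq (assertV n P) S) (Seq (Seq (assertV n P) S) (assertV n Q))
        \<longleftrightarrow> proj_le (2^n) (sp n S P) Q) \<and>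
    (proj_le (2^n) (sp n S P) Q \<longleftrightarrow> proj_le (2^n) P (wlp n S Q)) \<and>
    (proj_le (2^n) P (wlp n S Q) \<longleftrightarrow> valid n P S Q)) \<and>
    ((prog_equiv n (Seq S (assertV n Q)) (Seq (Seq (assertV n P) S) (assertV n Q))
        \<longleftrightarrow> proj_le (2^n) (sp n S (orth (2^n) P)) (orth (2^n) Q)) \<and>
    (proj_le (2^n) (sp n S (orth (2^n) P)) (orth (2^n) Q)
        \<longleftrightarrow> proj_le (2^n) (orth (2^n) P) (wlp n S (orth (2^n) Q))) \<and>
    (proj_le (2^n) (orth (2^n) P) (wlp n S (orth (2^n) Q))
        \<longleftrightarrow> valid n (orth (2^n) P) S (orth (2^n) Q)))"
proof -
  have E: "\<forall>E\<in>den n S. cone_op (2^n) E" using den_cone_op[OF assms(1)] by blast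
  have P': "is_proj (2^n) (orth (2^n) P)" and Q': "is_proj (2^n) (orth (2^n) Q)"
    using assms(2,3) by (auto intro: orth_is_proj)
  show ?thesis
    using assert_after_iff_valid[OF assms] assert_before_iff_valid[OF assms]
      sp_le_iff_valid[OF E assms(2,3)] le_wlp_iff_valid[OF E assms(2,3)]
      sp_le_iff_valid[OF E P' Q'] le_wlp_iff_valid[OF E P' Q']
    by blast
qed

end
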